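(* Let $f$ satisfy assumptions (A1)–(A4) of the context, let $\varepsilon>0$, $M=4\sqrt2\,\kappa^3\rho$, $C_g=1/192$, $C_H=1/48$, $\varepsilon'=2^{-2.5}\varepsilon$ and $$\tilde\varepsilon'=\min\Big\{\frac{C_g\varepsilon'}{\ell},\ \frac{C_H\sqrt{M\varepsilon'}}{\rho}\Big\}.$$ Run the algorithm MCN (see context) with tolerance $\varepsilon'$ and with $$T=\big\lceil 192\,(P(\mathbf x_0)-P^* )\sqrt{M}\,\varepsilon'^{-1.5}\big\rceil+1,\qquad K_0=\Big\lceil 2\sqrt{\kappa}\,\log\Big(\frac{\sqrt{\kappa+1}}{\tilde\varepsilon'}\|\mathbf y^*(\mathbf x_0)\|_2\Big)\Big\rceil,$$ $$K_t=\Big\lceil 2\sqrt{\kappa}\,\log\Big(\frac{\sqrt{\kappa+1}}{\tilde\varepsilon'}\big(\tilde\varepsilon'+\kappa\|\mathbf s_{t-1}^*\|_2\big)\Big)\Big\rceil\quad (t\ge 1).$$ Then the output $\hat{\mathbf x}$ is an $\big(\varepsilon,\kappa^{1.5}\sqrt{\rho\varepsilon}\,\big)$-second-order stationary point of $P$; the number of gradient oracle calls is at most $\tilde{\mathcal O}\big(\kappa^2\sqrt{\rho}\,\varepsilon^{-1.5}\big)$; and the total number of Hessian (inverse) oracle calls and exact cubic sub-problem solver calls is at most $\mathcal O\big(\kappa^{1.5}\sqrt{\rho}\,\varepsilon^{-1.5}\big)$.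
   Context: Notation: $\|\cdot\|_2$ is the Euclidean norm of vectors and the spectral norm of matrices. $f:\mathbb R^{d_x}\times\mathbb R^{d_y}\to\mathbb R$ is twice differentiable. Assumptions, with constants $\ell,\rho,\mu>0$: (A1) $\|\nabla f(\mathbf x,\mathbf y)-\nabla f(\mathbf x',\mathbf y')\|_2^2\le \ell^2(\|\mathbf x-\mathbf x'\|_2^2+\|\mathbf y-\mathbf y'\|_2^2)$ for all $\mathbf x,\mathbf x',\mathbf y,\mathbf y'$; (A2) $\|\nabla^2 f(\mathbf x,\mathbf y)-\nabla^2 f(\mathbf x',\mathbf y')\|_2^2\le \rho^2(\|\mathbf x-\mathbf x'\|_2^2+\|\mathbf y-\mathbf y'\|_2^2)$ for all $\mathbf x,\mathbf x',\mathbf y,\mathbf y'$; (A3) $f$ is $\mu$-strongly concave in $\mathbf y$: $f(\mathbf x,\mathbf y)\le f(\mathbf x,\mathbf y')+\nabla_y f(\mathbf x,\mathbf y')^\top(\mathbf y-\mathbf y')-\frac{\mu}{2}\|\mathbf y-\mathbf y'\|_2^2$ for all $\mathbf x,\mathbf y,\mathbf y'$; (A4) $P(\mathbf x)=\max_{\mathbf y\in\mathbb R^{d_y}}f(\mathbf x,\mathbf y)$ satisfies $P^*=\inf_{\mathbf x}P(\mathbf x)>-\infty$. Put $\kappa=\ell/\mu$, $\mathbf y^*(\mathbf x)=\arg\max_{\mathbf y}f(\mathbf x,\mathbf y)$, and $\mathbf H(\mathbf x,\mathbf y)=\nabla_{xx}^2f(\mathbf x,\mathbf y)-\nabla_{xy}^2f(\mathbf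 x,\mathbf y)\big(\nabla_{yy}^2f(\mathbf x,\mathbf y)\big)^{-1}\nabla_{yx}^2f(\mathbf x,\mathbf y)$. A point $\mathbf x$ is an $(\varepsilon,\delta)$-second-order stationary point of $P$ if $\|\nabla P(\mathbf x)\|_2\le\varepsilon$ and $\nabla^2P(\mathbf x)\succeq-\delta\mathbf I$. AGD$(h,\mathbf y_0,K,\eta,\theta)$: set $\tilde{\mathbf y}_0=\mathbf y_0$; for $k=0,\dots,K-1$ set $\mathbf y_{k+1}=\tilde{\mathbf y}_k-\eta\nabla h(\tilde{\mathbf y}_k)$, $\tilde{\mathbf y}_{k+1}=\mathbf y_{k+1}+\theta(\mathbf y_{k+1}-\mathbf y_k)$; return $\mathbf y_K$ (no step is performed if $K\le 0$). MCN (Minimax Cubic Newton), with inputs $\mathbf x_0\in\mathbb R^{d_x}$, $\mathbf y_{-1}=\mathbf 0$, $T$, $\{K_t\}$ and a tolerance $\epsilon$: for $t=0,\dots,T-1$: $\mathbf y_t=\mathrm{AGD}\big(-f(\mathbf x_t,\cdot),\mathbf y_{t-1},K_t,\frac1\ell,\frac{\sqrt\kappa-1}{\sqrt\kappa+1}\big)$; $\mathbf g_t=\nabla_xf(\mathbf x_t,\mathbf y_t)$, $\mathbf H_t=\mathbf H(\mathbf x_t,\mathbf y_t)$; $\mathbf s_t^*\in\arg\min_{\mathbf s\in\mathbb R^{d_x}}\big(\mathbf g_t^\top\mathbf s+\frac12\mathbf s^\top\mathbf H_t\mathbf s+\frac M6\|\mathbf s\|_2^3\big)$; if $\|\mathbf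 s_t^*\|_2\le\frac12\sqrt{\epsilon/M}$ then exit the loop; otherwise $\mathbf x_{t+1}=\mathbf x_t+\mathbf s_t^*$. The output is $\hat{\mathbf x}=\mathbf x_t+\mathbf s_t^*$ for the last $t$ executed. Complexity convention: a gradient oracle call evaluates $\nabla f$ at a point; a Hessian (inverse) oracle call forms $\mathbf H(\mathbf x,\mathbf y)$ at a point. $\mathcal O(\cdot)$ hides absolute constants and the initial gap $P(\mathbf x_0)-P^*$; $\tilde{\mathcal O}(\cdot)$ additionally hides factors logarithmic in the problem parameters ($\kappa,\ell,\rho,1/\varepsilon,\|\mathbf y^*(\mathbf x_0)\|_2,P(\mathbf x_0)-P^*$). *)

theory Defs
  imports "HOL-Analysis.Analysis"
begin

definition grad :: "('a::real_inner \<Rightarrow> real) \<Rightarrow> 'a \<Rightarrow> 'a" where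
  "grad f z = (THE D. GDERIV f z :> D)"

text \<open>The Hessian is represented as a linear operator, so the spectral norm is \<^const>\<open>onorm\<close>.\<close>

definition hess :: "('a::real_inner \<Rightarrow> real) \<Rightarrow> 'a \<Rightarrow> 'a \<Rightarrow> 'a" where
  "hess f z = frechet_derivative (grad f) (at z)"

definition twice_differentiable :: "('a::real_inner \<Rightarrow> real) \<Rightarrow> bool" where
  "twice_differentiable f \<longleftrightarrow>
     (\<forall>z. f differentiable (at z)) \<and> (\<forall>z. grad f differentiable (at z))"

context
  fixes f :: "'a::euclidean_space \<times> 'b::euclidean_space \<Rightarrow> real"
begin

definition grad_x :: "'a \<times> 'b \<Rightarrow> 'a" where "grad_x z = fst (grad f z)"
definition grad_y :: "'a \<times> 'b \<Rightarrow> 'b" where "grad_y z = snd (grad f z)"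

definition hess_xx :: "'a \<times> 'b \<Rightarrow> 'a \<Rightarrow> 'a" where "hess_xx z u = fst (hess f z (u, 0))"
definition hess_xy :: "'a \<times> 'b \<Rightarrow> 'b \<Rightarrow> 'a" where "hess_xy z v = fst (hess f z (0, v))"
definition hess_yx :: "'a \<times> 'b \<Rightarrow> 'a \<Rightarrow> 'b" where "hess_yx z u = snd (hess f z (u, 0))"
definition hess_yy :: "'a \<times> 'b \<Rightarrow> 'b \<Rightarrow> 'b" where "hess_yy z v = snd (hess f z (0, v))"

definition schur_hess :: "'a \<times> 'b \<Rightarrow> 'a \<Rightarrow> 'a" where
  "schur_hess z u = hess_xx z u - hess_xy z (inv (hess_yy z) (hess_yx z u))"

text \<open>Under strong concavity in the second argument the supremum is attained, at a unique point.\<close>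

definition primal :: "'a \<Rightarrow> real" where
  "primal x = (SUP y. f (x, y))"

definition y_star :: "'a \<Rightarrow> 'b" where
  "y_star x = arg_max (\<lambda>y. f (x, y)) (\<lambda>_. True)"

end

text \<open>The gradient and Hessian of \<open>P\<close> are total functions with arbitrary values where
  derivatives do not exist; second-order stationarity therefore includes differentiability.\<close>

definition second_order_stationary ::
    "('a::euclidean_space \<Rightarrow> real) \<Rightarrow> real \<Rightarrow> real \<Rightarrow> 'a \<Rightarrow> bool" where
  "second_order_stationary P \<epsilon> \<delta> x \<longleftrightarrow>
     twice_differentiable P \<and>
     norm (grad P x) \<le> \<epsilon> \<and>
     (\<forall>v. v \<bullet> hess P x v \<ge> - \<delta> * (v \<bullet> v))"

definition agd_step ::
    "('b::euclidean_space \<Rightarrow> real) \<Rightarrow> real \<Rightarrow> real \<Rightarrow> 'b \<times> 'b \<Rightarrow> 'b \<times> 'b" where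
  "agd_step h \<eta> \<theta> = (\<lambda>(y, yt). let y' = yt - \<eta> *\<^sub>R grad h yt in (y', y' + \<theta> *\<^sub>R (y' - y)))"

definition agd ::
    "('b::euclidean_space \<Rightarrow> real) \<Rightarrow> 'b \<Rightarrow> int \<Rightarrow> real \<Rightarrow> real \<Rightarrow> 'b" where
  "agd h y0 K \<eta> \<theta> = fst ((agd_step h \<eta> \<theta> ^^ nat K) (y0, y0))"

definition cubic_model :: "'a::euclidean_space \<Rightarrow> ('a \<Rightarrow> 'a) \<Rightarrow> real \<Rightarrow> 'a \<Rightarrow> real" where
  "cubic_model g H M s = g \<bullet> s + 1/2 * (s \<bullet> H s) + M/6 * norm s ^ 3"

text \<open>\<open>x\<close>, \<open>y\<close>, \<open>s\<close> are the iterates of a complete execution that performs exactly \<open>N\<close> passes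
  through the loop body (\<open>t = 0, \<dots>, N - 1\<close>). It is a relation because the cubic subproblem may
  have several minimisers. The values of \<open>x\<close>, \<open>y\<close>, \<open>s\<close>, \<open>K\<close> at indices \<open>t \<ge> N\<close> are irrelevant.\<close>

definition mcn_run ::
    "('a::euclidean_space \<times> 'b::euclidean_space \<Rightarrow> real) \<Rightarrow> real \<Rightarrow> real \<Rightarrow> real \<Rightarrow> real \<Rightarrow>
     nat \<Rightarrow> (nat \<Rightarrow> int) \<Rightarrow> 'a \<Rightarrow> (nat \<Rightarrow> 'a) \<Rightarrow> (nat \<Rightarrow> 'b) \<Rightarrow> (nat \<Rightarrow> 'a) \<Rightarrow> nat \<Rightarrow> bool" where
  "mcn_run f l \<kappa> M tol T K x0 x y s N \<longleftrightarrow>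
     1 \<le> N \<and> N \<le> T \<and> x 0 = x0 \<and>
     (\<forall>t<N. y t = agd (\<lambda>v. - f (x t, v)) (if t = 0 then 0 else y (t - 1)) (K t)
                    (1 / l) ((sqrt \<kappa> - 1) / (sqrt \<kappa> + 1))) \<and>
     (\<forall>t<N. is_arg_min (cubic_model (grad_x f (x t, y t)) (schur_hess f (x t, y t)) M)
                (\<lambda>_. True) (s t)) \<and>
     (\<forall>t. Suc t < N \<longrightarrow> \<not> norm (s t) \<le> 1/2 * sqrt (tol / M) \<and> x (Suc t) = x t + s t) \<and>
     (N = T \<or> norm (s (N - 1)) \<le> 1/2 * sqrt (tol / M))"

definition mcn_output :: "(nat \<Rightarrow> 'a::euclidean_space) \<Rightarrow> (nat \<Rightarrow> 'a) \<Rightarrow> nat \<Rightarrow> 'a" where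
  "mcn_output x s N = x (N - 1) + s (N - 1)"

text \<open>Pass \<open>t\<close> evaluates the gradient of \<open>f\<close> once per AGD step and once more for \<open>g\<^sub>t\<close>;
  it forms one matrix \<open>H\<^sub>t\<close> and solves one cubic subproblem.\<close>

definition gradient_calls :: "(nat \<Rightarrow> int) \<Rightarrow> nat \<Rightarrow> nat" where
  "gradient_calls K N = (\<Sum>t<N. nat (K t) + 1)"

definition hessian_calls :: "nat \<Rightarrow> nat" where
  "hessian_calls N = (\<Sum>t<N. 1)"

definition cubic_solver_calls :: "nat \<Rightarrow> nat" where
  "cubic_solver_calls N = (\<Sum>t<N. 1)"

text \<open>The absolute constant hidden by the O-notation. It is given numerically because it must
  not depend on the dimensions: an existential quantifier inside a theorem would be in the scope
  of the (implicitly universally quantified) types of \<open>x\<close> and \<open>y\<close>.\<close>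

definition abs_const :: real where
  "abs_const = 10 ^ 7"

text \<open>The orders \<open>O(\<kappa>^1.5 \<rho>^0.5 \<epsilon>^-1.5)\<close> of Hessian and solver calls and
  \<open>O~(\<kappa>^2 \<rho>^0.5 \<epsilon>^-1.5)\<close> of gradient calls, for all parameter values, with the hidden initial gap
  \<open>\<Delta> = P x0 - P*\<close> and the hidden logarithm written out; \<open>r\<close> is the norm of \<open>y_star x0\<close>.
  The loop body is always executed at least once, whereas the leading terms tend to 0 as \<open>\<epsilon>\<close>
  grows or \<open>\<Delta>\<close> tends to 0; the second summands account for a bounded number of passes. Once
  \<open>\<Delta> \<kappa>^1.5 \<rho>^0.5 \<epsilon>^-1.5 \<ge> 1\<close>, they are at most an absolute constant times the leading terms
  (then \<open>1/\<rho> \<le> \<Delta>^2 \<kappa>^3 / \<epsilon>^3\<close>, so \<open>ln (S + 1/\<rho>)\<close> is at most a constant times \<open>ln S\<close>).\<close>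

definition hessian_order :: "real \<Rightarrow> real \<Rightarrow> real \<Rightarrow> real \<Rightarrow> real" where
  "hessian_order \<Delta> \<kappa> \<rho> \<epsilon> = \<Delta> * (\<kappa> powr 1.5 * sqrt \<rho> * \<epsilon> powr (-1.5)) + 1"

definition gradient_order :: "real \<Rightarrow> real \<Rightarrow> real \<Rightarrow> real \<Rightarrow> real \<Rightarrow> real \<Rightarrow> real" where
  "gradient_order \<Delta> \<kappa> l \<rho> \<epsilon> r =
     (let S = 2 + \<kappa> + l + \<rho> + 1 / \<epsilon> + r + \<Delta>
      in \<Delta> * (\<kappa>\<^sup>2 * sqrt \<rho> * \<epsilon> powr (-1.5)) * ln S + sqrt \<kappa> * ln (S + 1 / \<rho>))"

end

theory Submission
  imports Defs
begin

text \<open>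
Write \<open>y*(x)\<close> for the inner maximiser and \<open>P\<close> for the maximum function. Strong concavity makes
\<open>y*\<close> \<open>\<kappa>\<close>-Lipschitz. Since the \<open>y\<close>-gradient vanishes along the curve \<open>(x, y*(x))\<close>, expanding \<open>f\<close> and its
gradient along the curve to second order shows that \<open>P\<close> is twice differentiable, that its gradient
is the \<open>x\<close>-gradient of \<open>f\<close> on the curve and that its Hessian is the Schur complement \<open>H\<close> there
(\<open>has_derivative_grad_primal\<close>). The Schur complement satisfies
\<open>\<langle>w, (H(z) - H(z')) u\<rangle> = \<langle>p, (F(z) - F(z')) q\<rangle>\<close>, where \<open>F\<close> is the Hessian of \<open>f\<close> and \<open>p\<close>, \<open>q\<close> extend
\<open>w\<close>, \<open>u\<close> by the linear response of the maximiser, so \<open>H\<close> is \<open>2\<kappa>\<^sup>2\<rho>\<close>-Lipschitz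
(\<open>schur_hess_Lipschitz\<close>) and the Hessian of \<open>P\<close> is even \<open>M/2\<close>-Lipschitz.

Put \<open>r = sqrt (\<epsilon>'/M)\<close>, so that \<open>\<epsilon>' = M r\<^sup>2\<close> and \<open>sqrt (M \<epsilon>') = M r = (\<kappa> powr 1.5) sqrt (\<rho>\<epsilon>)\<close>. Nesterov's
potential argument (\<open>agd_linear_convergence\<close>) shows that the prescribed numbers of inner steps keep
every \<open>y\<^sub>t\<close> within the inner tolerance of \<open>y*(x\<^sub>t)\<close>. The gradient error is then at most
\<open>M r\<^sup>2 / 192\<close>. The Hessian error is at most the Lipschitz constant \<open>2\<kappa>\<^sup>2\<rho>\<close> of \<open>H\<close> times the inner error; it is
bounded by \<open>M r / 10\<close> (\<open>hessian_error\<close>): if \<open>M r \<le> 40 \<kappa> l\<close>, because the inner tolerance is at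
most \<open>C\<^sub>g \<epsilon>' / l\<close>, and otherwise because both matrices have norm at most \<open>2 \<kappa> l\<close>.

With these errors, and with the factor 2 to spare in \<open>M\<close>, a step longer than \<open>r/2\<close> decreases \<open>P\<close> by
\<open>M r\<^sup>3 / 192\<close> (\<open>long_step_decrease\<close>), which can happen at most
\<open>192 (P(x\<^sub>0) - P*) / (M r\<^sup>3)\<close> times, so that the loop ends with a step of length at most \<open>r/2\<close>. After such a step
the optimality conditions of the cubic model give the bounds on the gradient and on the
curvature (\<open>short_step_gradient\<close>, \<open>short_step_curvature\<close>).

The number of passes is bounded by the budget \<open>T\<close>. Each pass costs \<open>O(sqrt \<kappa>)\<close> gradients times the logarithm of a
quantity polynomial in the parameters: the decrease of \<open>P\<close> also bounds each single step length, hence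
the distance that the inner maximiser moves between two passes.
\<close>

section \<open>Taylor estimates for functions with a Lipschitz derivative\<close>

text \<open>The mean value theorem in the form from which all remainder estimates below are derived: one compares
  a function on a segment with an explicit polynomial.\<close>

lemma increment_le_increment:
  fixes \<phi> q :: "real \<Rightarrow> real"
  assumes "\<And>t. (\<phi> has_real_derivative \<phi>' t) (at t)"
    and "\<And>t. (q has_real_derivative q' t) (at t)"
    and "\<And>t. 0 \<le> t \<Longrightarrow> t \<le> 1 \<Longrightarrow> \<phi>' t \<le> q' t"
  shows "\<phi> 1 - \<phi> 0 \<le> q 1 - q 0"
proof -
  have "(\<lambda>t. q t - \<phi> t) 0 \<le> (\<lambda>t. q t - \<phi> t) 1"
  proof (rule DERIV_nonneg_imp_nondecreasing[where f = "\<lambda>t. q t - \<phi> t"])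
    fix t :: real assume "0 \<le> t" "t \<le> 1"
    then show "\<exists>y. ((\<lambda>t. q t - \<phi> t) has_real_derivative y) (at t) \<and> 0 \<le> y"
      using assms DERIV_diff[OF assms(2)[of t] assms(1)[of t]] by (metis diff_ge_0_iff_ge)
  qed simp
  then show ?thesis by simp
qed

text \<open>Infinitesimal inequalities are obtained from inequalities for steps of length \<open>t\<close> by letting
  \<open>t\<close> tend to 0.\<close>

lemma le_if_vanishing_error:
  fixes a b c :: real
  assumes "\<And>t. 0 < t \<Longrightarrow> t \<le> 1 \<Longrightarrow> a \<le> b + t * c"
  shows "a \<le> b"
proof (rule tendsto_lowerbound[where F = "at_right 0"])
  have "((\<lambda>t. b + t * c) \<longlongrightarrow> b + 0 * c) (at_right 0)" by (intro tendsto_intros)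
  then show "((\<lambda>t. b + t * c) \<longlongrightarrow> b) (at_right 0)" by simp
  show "\<forall>\<^sub>F t in at_right 0. a \<le> b + t * c"
    using assms by (auto simp: eventually_at_right_field intro!: exI[of _ 1])
qed simp

lemma GDERIV_unique: "GDERIV f z :> D \<Longrightarrow> GDERIV f z :> D' \<Longrightarrow> D = D'"
proof -
  assume "GDERIV f z :> D" "GDERIV f z :> D'"
  then have "(\<lambda>h. h \<bullet> D) = (\<lambda>h. h \<bullet> D')"
    unfolding gderiv_def by (rule has_derivative_unique)
  then have "(D - D') \<bullet> D = (D - D') \<bullet> D'" by metis
  then have "(D - D') \<bullet> (D - D') = 0" by (simp add: inner_diff_right)
  then show ?thesis by simp
qed

lemma grad_eqI: "GDERIV f z :> D \<Longrightarrow> grad f z = D"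
  unfolding grad_def using GDERIV_unique by blast

text \<open>Existence of the gradient is the Riesz representation of the derivative, which is explicit in an
  orthonormal basis.\<close>

lemma GDERIV_grad:
  fixes f :: "'a::euclidean_space \<Rightarrow> real"
  assumes "f differentiable (at z)"
  shows "GDERIV f z :> grad f z"
proof -
  obtain f' where f': "(f has_derivative f') (at z)"
    using assms unfolding differentiable_def by blast
  interpret linear f' using f' has_derivative_linear by blast
  have "f' h = h \<bullet> (\<Sum>b\<in>Basis. f' b *\<^sub>R b)" for h
  proof -
    have "f' h = f' (\<Sum>b\<in>Basis. (h \<bullet> b) *\<^sub>R b)" by (simp add: euclidean_representation)
    also have "\<dots> = (\<Sum>b\<in>Basis. (h \<bullet> b) * f' b)" by (simp add: sum scale)
    also have "\<dots> = h \<bullet> (\<Sum>b\<in>Basis. f' b *\<^sub>R b)"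
      by (simp add: inner_sum_right mult.commute)
    finally show ?thesis .
  qed
  then have "GDERIV f z :> (\<Sum>b\<in>Basis. f' b *\<^sub>R b)"
    using f' unfolding gderiv_def by (metis (no_types, lifting) ext)
  then show ?thesis using grad_eqI by metis
qed

lemma has_derivative_hess:
  assumes "grad f differentiable (at z)"
  shows "(grad f has_derivative hess f z) (at z)"
  using assms frechet_derivative_works unfolding hess_def by blast

lemma has_derivative_quadratic_remainder:
  fixes G :: "'a::real_normed_vector \<Rightarrow> 'b::real_normed_vector"
  assumes "bounded_linear D"
    and "\<And>w. norm (G w - G z - D (w - z)) \<le> c * (norm (w - z))\<^sup>2"
  shows "(G has_derivative D) (at z)"
proof (rule has_derivativeI_sandwich[where e = 1 and H = "\<lambda>w. c * norm (w - z)"])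
  show "((\<lambda>w. c * norm (w - z)) \<longlongrightarrow> 0) (at z)"
    by (rule tendsto_eq_intros | simp)+
  show "norm (G w - G z - D (w - z)) / norm (w - z) \<le> c * norm (w - z)" if "w \<noteq> z" for w
    using assms(2)[of w] that by (simp add: divide_le_eq power2_eq_square mult.assoc)
qed (use assms in auto)

lemma DERIV_along_line:
  assumes "\<And>w. GDERIV f w :> g w"
  shows "((\<lambda>t. f (z + t *\<^sub>R u)) has_real_derivative g (z + t *\<^sub>R u) \<bullet> u) (at t)"
proof -
  have "((\<lambda>t. f (z + t *\<^sub>R u)) has_derivative (\<lambda>h. (h *\<^sub>R u) \<bullet> g (z + t *\<^sub>R u))) (at t)"
    using assms[of "z + t *\<^sub>R u"] unfolding gderiv_def
    by (rule has_derivative_compose[rotated]) (auto intro!: derivative_eq_intros)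
  then show ?thesis
    by (simp add: has_field_derivative_def inner_commute mult.commute[of _ "_ \<bullet> _"])
qed

lemma DERIV_inner_along_line:
  fixes g :: "'a::real_normed_vector \<Rightarrow> 'b::real_inner"
  assumes "\<And>w. (g has_derivative D w) (at w)"
  shows "((\<lambda>t. g (z + t *\<^sub>R u) \<bullet> e) has_real_derivative D (z + t *\<^sub>R u) u \<bullet> e) (at t)"
proof -
  have "((\<lambda>t. g (z + t *\<^sub>R u)) has_derivative (\<lambda>h. D (z + t *\<^sub>R u) (h *\<^sub>R u))) (at t)"
    using assms[of "z + t *\<^sub>R u"]
    by (rule has_derivative_compose[rotated]) (auto intro!: derivative_eq_intros)
  then have "((\<lambda>t. g (z + t *\<^sub>R u) \<bullet> e) has_derivative (\<lambda>h. D (z + t *\<^sub>R u) (h *\<^sub>R u) \<bullet> e)) (at t)"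
    by (rule has_derivative_inner_left)
  moreover have "D (z + t *\<^sub>R u) (h *\<^sub>R u) \<bullet> e = D (z + t *\<^sub>R u) u \<bullet> e * h" for h
    using linear_scale[OF has_derivative_linear[OF assms[of "z + t *\<^sub>R u"]]] by simp
  ultimately show ?thesis by (simp add: has_field_derivative_def)
qed

lemma descent_lemma:
  assumes f: "\<And>w. GDERIV f w :> g w"
    and Lip: "\<And>v w. norm (g v - g w) \<le> L * norm (v - w)"
  shows "\<bar>f w - f z - g z \<bullet> (w - z)\<bar> \<le> L / 2 * (norm (w - z))\<^sup>2"
proof -
  define d where "d = w - z"
  have near: "\<bar>(g (z + t *\<^sub>R d) - g z) \<bullet> d\<bar> \<le> L * t * (norm d)\<^sup>2" if "0 \<le> t" for t
  proof -
    have "\<bar>(g (z + t *\<^sub>R d) - g z) \<bullet> d\<bar> \<le> norm (g (z + t *\<^sub>R d) - g z) * norm d"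
      by (rule Cauchy_Schwarz_ineq2)
    also have "\<dots> \<le> (L * norm (z + t *\<^sub>R d - z)) * norm d"
      by (intro mult_right_mono Lip norm_ge_zero)
    finally show ?thesis using that by (simp add: power2_eq_square mult_ac)
  qed
  have "f (z + 1 *\<^sub>R d) - f (z + 0 *\<^sub>R d) \<le> (\<lambda>t. t * (g z \<bullet> d) + L / 2 * t\<^sup>2 * (norm d)\<^sup>2) 1
      - (\<lambda>t. t * (g z \<bullet> d) + L / 2 * t\<^sup>2 * (norm d)\<^sup>2) 0"
  proof (rule increment_le_increment[where q' = "\<lambda>t. g z \<bullet> d + L * t * (norm d)\<^sup>2", OF DERIV_along_line[OF f]])
    show "((\<lambda>t. t * (g z \<bullet> d) + L / 2 * t\<^sup>2 * (norm d)\<^sup>2) has_real_derivative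
        g z \<bullet> d + L * t * (norm d)\<^sup>2) (at t)" for t
      by (auto intro!: derivative_eq_intros)
    show "g (z + t *\<^sub>R d) \<bullet> d \<le> g z \<bullet> d + L * t * (norm d)\<^sup>2" if "0 \<le> t" for t
      using near[OF that] by (simp add: inner_diff_left)
  qed
  moreover have "(\<lambda>t. t * (g z \<bullet> d) - L / 2 * t\<^sup>2 * (norm d)\<^sup>2) 1
      - (\<lambda>t. t * (g z \<bullet> d) - L / 2 * t\<^sup>2 * (norm d)\<^sup>2) 0 \<le> f (z + 1 *\<^sub>R d) - f (z + 0 *\<^sub>R d)"
  proof (rule increment_le_increment[where \<phi>' = "\<lambda>t. g z \<bullet> d - L * t * (norm d)\<^sup>2", OF _ DERIV_along_line[OF f]])
    show "((\<lambda>t. t * (g z \<bullet> d) - L / 2 * t\<^sup>2 * (norm d)\<^sup>2) has_real_derivative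
        g z \<bullet> d - L * t * (norm d)\<^sup>2) (at t)" for t
      by (auto intro!: derivative_eq_intros)
    show "g z \<bullet> d - L * t * (norm d)\<^sup>2 \<le> g (z + t *\<^sub>R d) \<bullet> d" if "0 \<le> t" for t
      using near[OF that] by (simp add: inner_diff_left)
  qed
  ultimately show ?thesis unfolding d_def abs_le_iff by simp
qed

lemma derivative_taylor_bound:
  fixes g :: "'a::real_normed_vector \<Rightarrow> 'b::real_inner"
  assumes g: "\<And>w. (g has_derivative D w) (at w)"
    and Lip: "\<And>v w e. norm (D v e - D w e) \<le> L * norm (v - w) * norm e"
  shows "norm (g w - g z - D z (w - z)) \<le> L / 2 * (norm (w - z))\<^sup>2"
proof -
  define d where "d = w - z"
  define e where "e = g w - g z - D z d"
  have "g (z + 1 *\<^sub>R d) \<bullet> e - g (z + 0 *\<^sub>R d) \<bullet> e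
      \<le> (\<lambda>t. t * (D z d \<bullet> e) + L / 2 * t\<^sup>2 * ((norm d)\<^sup>2 * norm e)) 1
      - (\<lambda>t. t * (D z d \<bullet> e) + L / 2 * t\<^sup>2 * ((norm d)\<^sup>2 * norm e)) 0"
  proof (rule increment_le_increment[where q' = "\<lambda>t. D z d \<bullet> e + L * t * ((norm d)\<^sup>2 * norm e)",
        OF DERIV_inner_along_line[OF g]])
    show "((\<lambda>t. t * (D z d \<bullet> e) + L / 2 * t\<^sup>2 * ((norm d)\<^sup>2 * norm e)) has_real_derivative
        D z d \<bullet> e + L * t * ((norm d)\<^sup>2 * norm e)) (at t)" for t
      by (auto intro!: derivative_eq_intros)
    show "D (z + t *\<^sub>R d) d \<bullet> e \<le> D z d \<bullet> e + L * t * ((norm d)\<^sup>2 * norm e)" if "0 \<le> t" for t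
    proof -
      have "(D (z + t *\<^sub>R d) d - D z d) \<bullet> e \<le> norm (D (z + t *\<^sub>R d) d - D z d) * norm e"
        by (rule norm_cauchy_schwarz)
      also have "\<dots> \<le> (L * norm (z + t *\<^sub>R d - z) * norm d) * norm e"
        by (intro mult_right_mono Lip norm_ge_zero)
      finally show ?thesis using that by (simp add: inner_diff_left power2_eq_square mult_ac)
    qed
  qed
  then have "e \<bullet> e \<le> L / 2 * (norm d)\<^sup>2 * norm e"
    by (simp add: e_def d_def inner_diff_left)
  then have "norm e * norm e \<le> L / 2 * (norm d)\<^sup>2 * norm e"
    by (simp add: dot_square_norm power2_eq_square)
  moreover have "0 \<le> L / 2 * (norm d)\<^sup>2"
  proof (cases "d = 0")
    case False
    have "0 \<le> L * norm (w - z) * norm d" using Lip[of w d z] norm_ge_zero order_trans by blast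
    then have "0 \<le> L" using False by (simp add: d_def zero_le_mult_iff)
    then show ?thesis by simp
  qed simp
  ultimately have "norm e \<le> L / 2 * (norm d)\<^sup>2"
    by (cases "norm e = 0") (auto simp: mult_le_cancel_right)
  then show ?thesis by (simp add: e_def d_def)
qed

lemma cubic_taylor_upper_bound:
  fixes g :: "'a::real_inner \<Rightarrow> 'a"
  assumes f: "\<And>w. GDERIV f w :> g w"
    and g: "\<And>w. (g has_derivative D w) (at w)"
    and Lip: "\<And>v w e. norm (D v e - D w e) \<le> L * norm (v - w) * norm e"
  shows "f (z + d) \<le> f z + g z \<bullet> d + 1/2 * (d \<bullet> D z d) + L / 6 * norm d ^ 3"
proof -
  have "f (z + 1 *\<^sub>R d) - f (z + 0 *\<^sub>R d)
      \<le> (\<lambda>t. t * (g z \<bullet> d) + 1/2 * t\<^sup>2 * (d \<bullet> D z d) + L / 6 * t^3 * norm d ^ 3) 1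
      - (\<lambda>t. t * (g z \<bullet> d) + 1/2 * t\<^sup>2 * (d \<bullet> D z d) + L / 6 * t^3 * norm d ^ 3) 0"
  proof (rule increment_le_increment[where q' = "\<lambda>t. g z \<bullet> d + t * (d \<bullet> D z d) + L / 2 * t\<^sup>2 * norm d ^ 3",
        OF DERIV_along_line[OF f]])
    show "((\<lambda>t. t * (g z \<bullet> d) + 1/2 * t\<^sup>2 * (d \<bullet> D z d) + L / 6 * t^3 * norm d ^ 3) has_real_derivative
        g z \<bullet> d + t * (d \<bullet> D z d) + L / 2 * t\<^sup>2 * norm d ^ 3) (at t)" for t
      by (auto intro!: derivative_eq_intros simp: power2_eq_square)
    show "g (z + t *\<^sub>R d) \<bullet> d \<le> g z \<bullet> d + t * (d \<bullet> D z d) + L / 2 * t\<^sup>2 * norm d ^ 3" for t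
    proof -
      have "(g (z + t *\<^sub>R d) - g z - D z (t *\<^sub>R d)) \<bullet> d
          \<le> norm (g (z + t *\<^sub>R d) - g z - D z (t *\<^sub>R d)) * norm d"
        by (rule norm_cauchy_schwarz)
      also have "\<dots> \<le> L / 2 * (norm (t *\<^sub>R d))\<^sup>2 * norm d"
        using derivative_taylor_bound[OF g Lip, of "z + t *\<^sub>R d" z] by (intro mult_right_mono) auto
      finally have "(g (z + t *\<^sub>R d) - g z - D z (t *\<^sub>R d)) \<bullet> d \<le> L / 2 * t\<^sup>2 * norm d ^ 3"
        by (simp add: power_mult_distrib power2_eq_square power3_eq_cube mult_ac)
      moreover have "D z (t *\<^sub>R d) = t *\<^sub>R D z d"
        using linear_scale[OF has_derivative_linear[OF g]] by blast
      ultimately show ?thesis by (simp add: inner_diff_left inner_diff_right inner_commute)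
    qed
  qed
  then show ?thesis by simp
qed

text \<open>The mixed second difference is the increment of \<open>f (\<cdot> + v) - f\<close> along \<open>u\<close>; its derivative is close
  to \<open>D z v \<bullet> u\<close> by the Taylor bound for the gradient.\<close>

lemma mixed_difference_bound:
  fixes g :: "'a::real_inner \<Rightarrow> 'a"
  assumes f: "\<And>w. GDERIV f w :> g w"
    and g: "\<And>w. (g has_derivative D w) (at w)"
    and Lip: "\<And>v w e. norm (D v e - D w e) \<le> L * norm (v - w) * norm e"
    and L: "0 \<le> L"
  shows "\<bar>(f (z + u + v) - f (z + u) - f (z + v) + f z) - D z v \<bullet> u\<bar> \<le> L * (norm u + norm v) ^ 3"
proof -
  define \<phi> where "\<phi> t = f ((z + v) + t *\<^sub>R u) - f (z + t *\<^sub>R u)" for t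
  define \<phi>' where "\<phi>' t = g ((z + v) + t *\<^sub>R u) \<bullet> u - g (z + t *\<^sub>R u) \<bullet> u" for t
  define c where "c = L * (norm u + norm v) ^ 3"
  have der: "(\<phi> has_real_derivative \<phi>' t) (at t)" for t
    unfolding \<phi>_def \<phi>'_def by (intro DERIV_diff DERIV_along_line f)
  have near: "\<bar>\<phi>' t - D z v \<bullet> u\<bar> \<le> c" if t: "0 \<le> t" "t \<le> 1" for t
  proof -
    define e where "e p = g (z + p) - g z - D z p" for p
    have e: "norm (e p) \<le> L / 2 * (norm u + norm v)\<^sup>2" if "norm p \<le> norm u + norm v" for p
    proof -
      have "norm (e p) \<le> L / 2 * (norm p)\<^sup>2"
        using derivative_taylor_bound[OF g Lip, of "z + p" z] by (simp add: e_def)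
      also have "\<dots> \<le> L / 2 * (norm u + norm v)\<^sup>2"
        using that L by (intro mult_left_mono power_mono) auto
      finally show ?thesis .
    qed
    have tu: "norm (t *\<^sub>R u) \<le> norm u" using t by (simp add: mult_left_le_one_le)
    have lin: "linear (D z)" using g has_derivative_linear by blast
    have "\<phi>' t - D z v \<bullet> u = (e (v + t *\<^sub>R u) - e (t *\<^sub>R u)) \<bullet> u"
      by (simp add: \<phi>'_def e_def inner_diff_left inner_add_left linear_add[OF lin] add.assoc)
    also have "\<bar>\<dots>\<bar> \<le> norm (e (v + t *\<^sub>R u) - e (t *\<^sub>R u)) * norm u"
      by (rule Cauchy_Schwarz_ineq2)
    also have "\<dots> \<le> (L * (norm u + norm v)\<^sup>2) * norm u"
    proof (rule mult_right_mono)
      have "norm (v + t *\<^sub>R u) \<le> norm u + norm v" using tu norm_triangle_ineq[of v "t *\<^sub>R u"] by linarith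
      moreover have "norm (t *\<^sub>R u) \<le> norm u + norm v" using tu norm_ge_zero[of v] by linarith
      ultimately show "norm (e (v + t *\<^sub>R u) - e (t *\<^sub>R u)) \<le> L * (norm u + norm v)\<^sup>2"
        using e[of "v + t *\<^sub>R u"] e[of "t *\<^sub>R u"] norm_triangle_ineq4[of "e (v + t *\<^sub>R u)" "e (t *\<^sub>R u)"]
        by linarith
    qed simp
    also have "\<dots> \<le> (L * (norm u + norm v)\<^sup>2) * (norm u + norm v)"
      using L by (intro mult_left_mono) auto
    finally show ?thesis by (simp add: c_def power2_eq_square power3_eq_cube mult.assoc)
  qed
  have "\<phi> 1 - \<phi> 0 \<le> (\<lambda>t. t * (D z v \<bullet> u + c)) 1 - (\<lambda>t. t * (D z v \<bullet> u + c)) 0"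
    by (rule increment_le_increment[OF der, where q' = "\<lambda>_. D z v \<bullet> u + c"])
      (use near in \<open>auto intro!: derivative_eq_intros simp: abs_le_iff field_simps\<close>)
  moreover have "(\<lambda>t. t * (D z v \<bullet> u - c)) 1 - (\<lambda>t. t * (D z v \<bullet> u - c)) 0 \<le> \<phi> 1 - \<phi> 0"
    by (rule increment_le_increment[OF _ der, where \<phi>' = "\<lambda>_. D z v \<bullet> u - c"])
      (use near in \<open>auto intro!: derivative_eq_intros simp: abs_le_iff field_simps\<close>)
  ultimately have "\<bar>(\<phi> 1 - \<phi> 0) - D z v \<bullet> u\<bar> \<le> c" by (simp add: abs_le_iff)
  moreover have "\<phi> 1 - \<phi> 0 = f (z + u + v) - f (z + u) - f (z + v) + f z"
    by (simp add: \<phi>_def algebra_simps)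
  ultimately show ?thesis by (simp add: c_def)
qed

text \<open>The mixed second difference is symmetric in \<open>u\<close> and \<open>v\<close>, and for vectors of length \<open>t\<close> it determines
  both bilinear expressions up to an error of order \<open>t\<^sup>3\<close>.\<close>

lemma second_derivative_symmetric:
  fixes g :: "'a::real_inner \<Rightarrow> 'a"
  assumes f: "\<And>w. GDERIV f w :> g w"
    and g: "\<And>w. (g has_derivative D w) (at w)"
    and Lip: "\<And>v w e. norm (D v e - D w e) \<le> L * norm (v - w) * norm e"
    and L: "0 \<le> L"
  shows "D z v \<bullet> u = D z u \<bullet> v"
proof -
  define c where "c = 2 * L * (norm u + norm v) ^ 3"
  have lin: "linear (D z)" using g has_derivative_linear by blast
  have small: "\<bar>D z v \<bullet> u - D z u \<bullet> v\<bar> \<le> c * t" if t: "0 < t" for t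
  proof -
    let ?u = "t *\<^sub>R u" and ?v = "t *\<^sub>R v"
    have "\<bar>(f (z + ?u + ?v) - f (z + ?u) - f (z + ?v) + f z) - D z ?v \<bullet> ?u\<bar> \<le> L * (norm ?u + norm ?v) ^ 3"
      by (rule mixed_difference_bound[OF f g Lip L])
    moreover have "\<bar>(f (z + ?v + ?u) - f (z + ?v) - f (z + ?u) + f z) - D z ?u \<bullet> ?v\<bar> \<le> L * (norm ?v + norm ?u) ^ 3"
      by (rule mixed_difference_bound[OF f g Lip L])
    ultimately have "\<bar>D z ?v \<bullet> ?u - D z ?u \<bullet> ?v\<bar> \<le> 2 * L * (norm ?u + norm ?v) ^ 3"
      unfolding add.commute[of "norm ?v"] add.assoc add.commute[of ?v] by linarith
    also have "norm ?u + norm ?v = t * (norm u + norm v)"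
      using t by (simp add: distrib_left)
    also have "2 * L * (t * (norm u + norm v)) ^ 3 = (c * t) * t\<^sup>2"
      by (simp add: c_def power_mult_distrib power2_eq_square power3_eq_cube)
    also have "D z ?v \<bullet> ?u - D z ?u \<bullet> ?v = (D z v \<bullet> u - D z u \<bullet> v) * t\<^sup>2"
      by (simp add: linear_scale[OF lin] power2_eq_square algebra_simps)
    finally show ?thesis using t by (simp add: abs_mult)
  qed
  have "\<bar>D z v \<bullet> u - D z u \<bullet> v\<bar> \<le> 0"
    by (rule le_if_vanishing_error[of _ _ c]) (use small in \<open>simp add: mult.commute\<close>)
  then show ?thesis by simp
qed

section \<open>Linear convergence of accelerated gradient descent\<close>

text \<open>The state of the method is \<open>(y\<^sub>k, ytilde\<^sub>k)\<close>. Nesterov's potential adds to the optimality gap the squared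
  distance to the optimum of the extrapolated point \<open>ytilde\<^sub>k + R (ytilde\<^sub>k - y\<^sub>k)\<close>, where \<open>R\<close> is the square root of
  the condition number.\<close>

definition agd_potential :: "('b::euclidean_space \<Rightarrow> real) \<Rightarrow> real \<Rightarrow> real \<Rightarrow> 'b \<Rightarrow> 'b \<times> 'b \<Rightarrow> real" where
  "agd_potential h \<mu> R ys = (\<lambda>(y, yt). h y - h ys + \<mu> / 2 * (norm (yt + R *\<^sub>R (yt - y) - ys))\<^sup>2)"

text \<open>In terms of \<open>d = ytilde - ys\<close>, \<open>e = ytilde - y\<close> and the gradient \<open>\<gamma>\<close> at \<open>ytilde\<close>, one step moves the extrapolated point
  from \<open>d + R e\<close> to \<open>d + (R - 1) e - (R / l) \<gamma>\<close> (relative to \<open>ys\<close>). Weighting strong convexity at \<open>y\<close> by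
  \<open>1 - 1/R\<close> and at \<open>ys\<close> by \<open>1/R\<close>, all terms that contain \<open>\<gamma>\<close> cancel.\<close>

lemma agd_potential_decrease:
  fixes h :: "'b::euclidean_space \<Rightarrow> real"
  assumes h: "\<And>w. GDERIV h w :> g w"
    and Lip: "\<And>v w. norm (g v - g w) \<le> l * norm (v - w)"
    and sc: "\<And>v w. h w + g w \<bullet> (v - w) + \<mu> / 2 * (norm (v - w))\<^sup>2 \<le> h v"
    and \<mu>: "0 < \<mu>" and R: "1 \<le> R" "l = R\<^sup>2 * \<mu>"
  shows "agd_potential h \<mu> R ys (agd_step h (1 / l) ((R - 1) / (R + 1)) p)
    \<le> (1 - 1 / R) * agd_potential h \<mu> R ys p"
proof (cases p)
  case (Pair y yt)
  define \<gamma> where "\<gamma> = g yt"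
  define e where "e = yt - y"
  define d where "d = yt - ys"
  define yn where "yn = yt - (1 / l) *\<^sub>R \<gamma>"
  have l: "0 < l" using \<mu> R by simp
  have grad: "grad h yt = \<gamma>" using grad_eqI[OF h] by (simp add: \<gamma>_def)
  have step: "agd_step h (1 / l) ((R - 1) / (R + 1)) p = (yn, yn + ((R - 1) / (R + 1)) *\<^sub>R (yn - y))"
    by (simp add: Pair agd_step_def grad yn_def Let_def)
  have z: "yn + ((R - 1) / (R + 1)) *\<^sub>R (yn - y)
      + R *\<^sub>R (yn + ((R - 1) / (R + 1)) *\<^sub>R (yn - y) - yn) - ys = d + (R - 1) *\<^sub>R e - (R / l) *\<^sub>R \<gamma>"
  proof -
    have "yn + ((R - 1) / (R + 1)) *\<^sub>R (yn - y)
      + R *\<^sub>R (yn + ((R - 1) / (R + 1)) *\<^sub>R (yn - y) - yn) - ys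
      = yn - ys + ((R + 1) * ((R - 1) / (R + 1))) *\<^sub>R (yn - y)"
      unfolding distrib_right scaleR_add_left by (simp add: scaleR_scaleR)
    also have "(R + 1) * ((R - 1) / (R + 1)) = R - 1" using R by simp
    also have "yn - ys + (R - 1) *\<^sub>R (yn - y) = d + (R - 1) *\<^sub>R e - (R / l) *\<^sub>R \<gamma>"
      by (simp add: yn_def d_def e_def algebra_simps diff_divide_distrib)
    finally show ?thesis .
  qed
  have progress: "h yn \<le> h yt - 1 / (2 * l) * (\<gamma> \<bullet> \<gamma>)"
  proof -
    have "h yn - h yt - \<gamma> \<bullet> (yn - yt) \<le> l / 2 * (norm (yn - yt))\<^sup>2"
      using descent_lemma[OF h Lip, of yn yt] unfolding \<gamma>_def abs_le_iff by blast
    moreover have "l / 2 * (norm (yn - yt))\<^sup>2 = 1 / (2 * l) * (\<gamma> \<bullet> \<gamma>)"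
      using l by (simp add: yn_def power2_norm_eq_inner field_simps power2_eq_square[of l])
    moreover have "\<gamma> \<bullet> (yn - yt) = - (1 / l) * (\<gamma> \<bullet> \<gamma>)" by (simp add: yn_def)
    ultimately show ?thesis using l by (simp add: field_simps)
  qed
  have at_y: "h yt - \<gamma> \<bullet> e + \<mu> / 2 * (e \<bullet> e) \<le> h y"
    using sc[of yt y] by (simp add: \<gamma>_def e_def power2_norm_eq_inner inner_diff_right inner_diff_left inner_commute
      algebra_simps)
  have at_ys: "h yt - \<gamma> \<bullet> d + \<mu> / 2 * (d \<bullet> d) \<le> h ys"
    using sc[of yt ys] by (simp add: \<gamma>_def d_def power2_norm_eq_inner inner_diff_right inner_diff_left inner_commute
      algebra_simps)
  define q where "q = 1 / R"
  have q: "0 < q" "q \<le> 1" "R * q = 1" using R by (auto simp: q_def)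
  have Rl: "\<mu> * (R / l) = q" "\<mu> * (R / l)\<^sup>2 = 1 / l"
    using R \<mu> by (auto simp: q_def power2_eq_square field_simps)
  have new: "\<mu> * (norm (d + (R - 1) *\<^sub>R e - (R / l) *\<^sub>R \<gamma>))\<^sup>2
      = \<mu> * (d \<bullet> d + (R - 1)\<^sup>2 * (e \<bullet> e) + 2 * (R - 1) * (d \<bullet> e)) + (1 / l) * (\<gamma> \<bullet> \<gamma>)
        - 2 * q * (\<gamma> \<bullet> d) - 2 * (1 - q) * (\<gamma> \<bullet> e)"
  proof -
    have "\<mu> * (norm (d + (R - 1) *\<^sub>R e - (R / l) *\<^sub>R \<gamma>))\<^sup>2
      = \<mu> * (d \<bullet> d + (R - 1)\<^sup>2 * (e \<bullet> e) + 2 * (R - 1) * (d \<bullet> e)) + (\<mu> * (R / l)\<^sup>2) * (\<gamma> \<bullet> \<gamma>)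
        - 2 * (\<mu> * (R / l)) * (\<gamma> \<bullet> d) - 2 * (\<mu> * (R / l)) * (R - 1) * (\<gamma> \<bullet> e)"
      unfolding power2_norm_eq_inner
      by (simp add: inner_add_left inner_add_right inner_diff_left inner_diff_right inner_commute
          power2_eq_square algebra_simps diff_divide_distrib)
    moreover have "q * (R - 1) = 1 - q" using q by (simp add: algebra_simps)
    ultimately show ?thesis unfolding Rl by (metis (no_types, lifting) mult.assoc)
  qed
  have old: "(1 - q) * (\<mu> * (norm (yt + R *\<^sub>R (yt - y) - ys))\<^sup>2)
      = \<mu> * ((1 - q) * (d \<bullet> d) + ((1 - q) * R\<^sup>2) * (e \<bullet> e) + 2 * (R - 1) * (d \<bullet> e))"
  proof -
    have "yt + R *\<^sub>R (yt - y) - ys = d + R *\<^sub>R e" by (simp add: d_def e_def)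
    moreover have "(norm (d + R *\<^sub>R e))\<^sup>2 = d \<bullet> d + R\<^sup>2 * (e \<bullet> e) + 2 * R * (d \<bullet> e)"
      unfolding power2_norm_eq_inner
      by (simp add: inner_add_left inner_add_right inner_commute power2_eq_square)
    moreover have "(1 - q) * R = R - 1" using q by (simp add: algebra_simps)
    then have "(1 - q) * (d \<bullet> d + R\<^sup>2 * (e \<bullet> e) + 2 * R * (d \<bullet> e))
        = (1 - q) * (d \<bullet> d) + ((1 - q) * R\<^sup>2) * (e \<bullet> e) + 2 * (R - 1) * (d \<bullet> e)"
      by algebra
    ultimately show ?thesis by (metis mult.left_commute)
  qed
  \<comment> \<open>the convex combination of the two strong convexity inequalities with weights \<open>1 - q\<close> and \<open>q\<close>\<close>
  have "(1 - q) * (h yt - \<gamma> \<bullet> e + \<mu> / 2 * (e \<bullet> e)) \<le> (1 - q) * h y"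
    using at_y q by (intro mult_left_mono) auto
  moreover have "q * (h yt - \<gamma> \<bullet> d + \<mu> / 2 * (d \<bullet> d)) \<le> q * h ys"
    using at_ys q by (intro mult_left_mono) auto
  moreover have "(R - 1)\<^sup>2 - (1 - q) \<le> (1 - q) * R\<^sup>2"
  proof -
    have "(1 - q) * R\<^sup>2 = R\<^sup>2 - R" using q by (simp add: algebra_simps power2_eq_square)
    then show ?thesis using R q by (simp add: power2_eq_square algebra_simps)
  qed
  then have "\<mu> * (((R - 1)\<^sup>2 - (1 - q)) * (e \<bullet> e)) \<le> \<mu> * (((1 - q) * R\<^sup>2) * (e \<bullet> e))"
    using \<mu> by (intro mult_left_mono mult_right_mono) auto
  ultimately have "h yn - h ys + 1 / 2 * (\<mu> * (norm (d + (R - 1) *\<^sub>R e - (R / l) *\<^sub>R \<gamma>))\<^sup>2)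
      \<le> (1 - q) * (h y - h ys) + 1 / 2 * ((1 - q) * (\<mu> * (norm (yt + R *\<^sub>R (yt - y) - ys))\<^sup>2))"
    unfolding new old using progress by (simp add: algebra_simps diff_divide_distrib)
  then have "h yn - h ys + 1 / 2 * (\<mu> * (norm (d + (R - 1) *\<^sub>R e - (R / l) *\<^sub>R \<gamma>))\<^sup>2)
      \<le> (1 - q) * (h y - h ys + 1 / 2 * (\<mu> * (norm (yt + R *\<^sub>R (yt - y) - ys))\<^sup>2))"
    by (simp add: distrib_left)
  then show ?thesis
    unfolding step unfolding Pair agd_potential_def prod.case z q_def by simp
qed

text \<open>At the start the potential is at most \<open>(l + \<mu>) / 2\<close> times the squared distance to the optimum, and it is always
  at least \<open>\<mu> / 2\<close> times that squared distance; the ratio of the two constants is \<open>\<kappa> + 1\<close>.\<close>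

lemma agd_linear_convergence:
  fixes h :: "'b::euclidean_space \<Rightarrow> real"
  assumes h: "\<And>w. GDERIV h w :> g w"
    and Lip: "\<And>v w. norm (g v - g w) \<le> l * norm (v - w)"
    and sc: "\<And>v w. h w + g w \<bullet> (v - w) + \<mu> / 2 * (norm (v - w))\<^sup>2 \<le> h v"
    and \<mu>: "0 < \<mu>" and \<kappa>: "1 \<le> \<kappa>" "l = \<kappa> * \<mu>"
    and crit: "g ys = 0"
  shows "norm (agd h y0 K (1 / l) ((sqrt \<kappa> - 1) / (sqrt \<kappa> + 1)) - ys)
    \<le> sqrt (\<kappa> + 1) * exp (- (real (nat K) / (2 * sqrt \<kappa>))) * norm (y0 - ys)"
proof -
  define R where "R = sqrt \<kappa>"
  have R: "1 \<le> R" "l = R\<^sup>2 * \<mu>" using \<kappa> by (auto simp: R_def)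
  define V where "V = agd_potential h \<mu> R ys"
  define st where "st n = (agd_step h (1 / l) ((R - 1) / (R + 1)) ^^ n) (y0, y0)" for n
  have V: "V (st n) \<le> (1 - 1 / R) ^ n * V (st 0)" for n
  proof (induction n)
    case (Suc n)
    have "V (st (Suc n)) \<le> (1 - 1 / R) * V (st n)"
      using agd_potential_decrease[OF h Lip sc \<mu> R] by (simp add: V_def st_def)
    also have "\<dots> \<le> (1 - 1 / R) * ((1 - 1 / R) ^ n * V (st 0))"
      using Suc R by (intro mult_left_mono) auto
    finally show ?case by (simp add: mult.assoc)
  qed simp
  define n where "n = nat K"
  define yK where "yK = fst (st n)"
  have "\<mu> / 2 * (norm (yK - ys))\<^sup>2 \<le> h yK - h ys"
    using sc[of ys yK] crit by simp
  also have "\<dots> \<le> V (st n)"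
    using \<mu> by (simp add: V_def agd_potential_def yK_def split: prod.split)
  also have "\<dots> \<le> (1 - 1 / R) ^ n * V (st 0)" by (rule V)
  also have "\<dots> \<le> exp (- (n / R)) * (l / 2 * (norm (y0 - ys))\<^sup>2 + \<mu> / 2 * (norm (y0 - ys))\<^sup>2)"
  proof (rule mult_mono)
    have "(1 - 1 / R) ^ n \<le> exp (- (1 / R)) ^ n"
      using R exp_ge_add_one_self[of "- (1 / R)"] by (intro power_mono) auto
    also have "\<dots> = exp (- (n / R))" by (simp add: exp_of_nat_mult[symmetric])
    finally show "(1 - 1 / R) ^ n \<le> exp (- (n / R))" .
    have "h y0 - h ys \<le> l / 2 * (norm (y0 - ys))\<^sup>2"
      using descent_lemma[OF h Lip, of y0 ys] unfolding abs_le_iff crit by simp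
    then show "V (st 0) \<le> l / 2 * (norm (y0 - ys))\<^sup>2 + \<mu> / 2 * (norm (y0 - ys))\<^sup>2"
      by (simp add: V_def agd_potential_def st_def)
    have "0 \<le> h y0 - h ys" using sc[of ys y0] crit \<mu>
      by (smt (verit) inner_zero_left mult_nonneg_nonneg zero_le_power2 divide_nonneg_pos)
    then show "0 \<le> V (st 0)" using \<mu> by (simp add: V_def agd_potential_def st_def)
  qed simp
  also have "\<dots> = \<mu> / 2 * (exp (- (n / R)) * (\<kappa> + 1) * (norm (y0 - ys))\<^sup>2)"
    using \<kappa> by (simp add: algebra_simps)
  finally have "(norm (yK - ys))\<^sup>2 \<le> exp (- (n / R)) * (\<kappa> + 1) * (norm (y0 - ys))\<^sup>2"
    using \<mu> by simp
  also have "\<dots> = (sqrt (\<kappa> + 1) * exp (- (n / (2 * R))) * norm (y0 - ys))\<^sup>2"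
    using \<kappa> by (simp add: power_mult_distrib exp_double[symmetric] mult_ac)
  finally have "norm (yK - ys) \<le> sqrt (\<kappa> + 1) * exp (- (n / (2 * R))) * norm (y0 - ys)"
    using \<kappa> by (auto intro: power2_le_imp_le)
  then show ?thesis by (simp add: yK_def st_def n_def agd_def R_def)
qed

text \<open>If \<open>D = 0\<close>, the logarithm takes the default value 0 and no step need be performed; the starting
  point is then already optimal.\<close>

lemma agd_accuracy:
  fixes h :: "'b::euclidean_space \<Rightarrow> real"
  assumes h: "\<And>w. GDERIV h w :> g w"
    and Lip: "\<And>v w. norm (g v - g w) \<le> l * norm (v - w)"
    and sc: "\<And>v w. h w + g w \<bullet> (v - w) + \<mu> / 2 * (norm (v - w))\<^sup>2 \<le> h v"
    and \<mu>: "0 < \<mu>" and \<kappa>: "1 \<le> \<kappa>" "l = \<kappa> * \<mu>"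
    and crit: "g ys = 0"
    and tol: "0 < tol" and D: "norm (y0 - ys) \<le> D"
    and K: "2 * sqrt \<kappa> * ln (sqrt (\<kappa> + 1) / tol * D) \<le> real_of_int K"
  shows "norm (agd h y0 K (1 / l) ((sqrt \<kappa> - 1) / (sqrt \<kappa> + 1)) - ys) \<le> tol"
proof -
  define E where "E = exp (- (real (nat K) / (2 * sqrt \<kappa>)))"
  have "norm (agd h y0 K (1 / l) ((sqrt \<kappa> - 1) / (sqrt \<kappa> + 1)) - ys) \<le> sqrt (\<kappa> + 1) * E * norm (y0 - ys)"
    unfolding E_def by (rule agd_linear_convergence[OF h Lip sc \<mu> \<kappa> crit])
  also have "\<dots> \<le> sqrt (\<kappa> + 1) * E * D"
    using D \<kappa> by (intro mult_left_mono) (auto simp: E_def)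
  also have "\<dots> \<le> tol"
  proof (cases "D = 0")
    case False
    then have D0: "0 < D" using D norm_ge_zero order_trans by (metis less_eq_real_def)
    have pos: "0 < sqrt (\<kappa> + 1) / tol * D" using D0 tol \<kappa> by simp
    have "2 * sqrt \<kappa> * ln (sqrt (\<kappa> + 1) / tol * D) \<le> real (nat K)" using K by linarith
    then have "ln (sqrt (\<kappa> + 1) / tol * D) \<le> real (nat K) / (2 * sqrt \<kappa>)"
      using \<kappa> by (simp add: field_simps)
    then have "sqrt (\<kappa> + 1) / tol * D \<le> exp (real (nat K) / (2 * sqrt \<kappa>))"
      using pos by (metis exp_le_cancel_iff exp_ln)
    then show ?thesis using tol by (simp add: E_def exp_minus field_simps)
  qed (use tol in simp)
  finally show ?thesis .
qed

section \<open>The maximum function of a strongly concave minimax problem\<close>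

lemma norm_fst_le_norm: "norm (fst p) \<le> norm p"
  by (cases p) (simp add: norm_fst_le)

lemma norm_snd_le_norm: "norm (snd p) \<le> norm p"
  by (cases p) (simp add: norm_snd_le)

text \<open>The condition number \<open>\<kappa>\<close> is a parameter tied to \<open>l\<close> and \<open>\<mu>\<close> by an equation, so that instances may use
  their own name for it.\<close>

locale strongly_concave_minimax =
  fixes f :: "'a::euclidean_space \<times> 'b::euclidean_space \<Rightarrow> real"
    and l \<rho> \<mu> \<kappa> :: real
  assumes pos: "l > 0" "\<rho> > 0" "\<mu> > 0"
    and diff: "twice_differentiable f"
    and grad_Lipschitz_sq: "\<And>x x' y y'. (norm (grad f (x, y) - grad f (x', y')))\<^sup>2
               \<le> l\<^sup>2 * ((norm (x - x'))\<^sup>2 + (norm (y - y'))\<^sup>2)"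
    and hess_Lipschitz_sq: "\<And>x x' y y'. (onorm (\<lambda>w. hess f (x, y) w - hess f (x', y') w))\<^sup>2
               \<le> \<rho>\<^sup>2 * ((norm (x - x'))\<^sup>2 + (norm (y - y'))\<^sup>2)"
    and strong_concavity: "\<And>x y y'. f (x, y) \<le> f (x, y') + grad_y f (x, y') \<bullet> (y - y')
               - \<mu> / 2 * (norm (y - y'))\<^sup>2"
    and kappa: "\<kappa> = l / \<mu>"
begin

lemma GDERIV_f: "GDERIV f z :> grad f z"
  using diff GDERIV_grad unfolding twice_differentiable_def by blast

lemma has_derivative_grad_f: "(grad f has_derivative hess f z) (at z)"
  using diff has_derivative_hess unfolding twice_differentiable_def by blast

lemma linear_hess: "linear (hess f z)"
  using has_derivative_grad_f has_derivative_linear by blast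

lemma bounded_linear_hess: "bounded_linear (hess f z)"
  using has_derivative_grad_f has_derivative_bounded_linear by blast

lemma grad_Lipschitz: "norm (grad f z - grad f w) \<le> l * norm (z - w)"
proof (rule power2_le_imp_le)
  show "(norm (grad f z - grad f w))\<^sup>2 \<le> (l * norm (z - w))\<^sup>2"
    using grad_Lipschitz_sq[of "fst z" "snd z" "fst w" "snd w"]
    by (simp add: power_mult_distrib norm_prod_def)
qed (use pos in simp)

lemma hess_Lipschitz: "norm (hess f z e - hess f w e) \<le> \<rho> * norm (z - w) * norm e"
proof -
  let ?D = "\<lambda>e. hess f z e - hess f w e"
  have bl: "bounded_linear ?D" by (intro bounded_linear_sub bounded_linear_hess)
  have "onorm ?D \<le> \<rho> * norm (z - w)"
  proof (rule power2_le_imp_le)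
    show "(onorm ?D)\<^sup>2 \<le> (\<rho> * norm (z - w))\<^sup>2"
      using hess_Lipschitz_sq[of "fst z" "snd z" "fst w" "snd w"]
      by (simp add: power_mult_distrib norm_prod_def)
  qed (use pos in simp)
  then have "onorm ?D * norm e \<le> \<rho> * norm (z - w) * norm e"
    by (intro mult_right_mono) auto
  then show ?thesis using onorm[OF bl, of e] by simp
qed

lemmas grad_remainder = derivative_taylor_bound[OF has_derivative_grad_f hess_Lipschitz]

lemma hess_symmetric: "hess f z v \<bullet> u = hess f z u \<bullet> v"
  using pos by (intro second_derivative_symmetric[OF GDERIV_f has_derivative_grad_f hess_Lipschitz]) simp

lemma hess_bound: "norm (hess f z e) \<le> l * norm e"
proof -
  have small: "norm (hess f z e) \<le> l * norm e + t * (\<rho> / 2 * (norm e)\<^sup>2)" if t: "0 < t" for t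
  proof -
    have "norm (hess f z (t *\<^sub>R e)) \<le> norm (grad f (z + t *\<^sub>R e) - grad f z)
        + norm (grad f (z + t *\<^sub>R e) - grad f z - hess f z (t *\<^sub>R e))"
      using norm_triangle_sub norm_minus_commute by metis
    also have "\<dots> \<le> l * norm (t *\<^sub>R e) + \<rho> / 2 * (norm (t *\<^sub>R e))\<^sup>2"
      using grad_Lipschitz[of "z + t *\<^sub>R e" z] grad_remainder[of "z + t *\<^sub>R e" z] by (intro add_mono) auto
    also have "\<dots> = t * (l * norm e + t * (\<rho> / 2 * (norm e)\<^sup>2))"
      using t by (simp add: power2_eq_square algebra_simps)
    finally show ?thesis using t by (simp add: linear_scale[OF linear_hess])
  qed
  show ?thesis by (rule le_if_vanishing_error) (rule small)
qed

lemma grad_y_strongly_monotone: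
  "(grad_y f (x, y) - grad_y f (x, y')) \<bullet> (y - y') \<le> - \<mu> * (norm (y - y'))\<^sup>2"
  using strong_concavity[of x y y'] strong_concavity[of x y' y]
  by (simp add: inner_diff_left inner_diff_right norm_minus_commute algebra_simps)

lemma grad_y_Lipschitz: "norm (grad_y f z - grad_y f w) \<le> l * norm (z - w)"
  using grad_Lipschitz[of z w] norm_snd_le_norm[of "grad f z - grad f w"] by (simp add: grad_y_def)

lemma grad_x_Lipschitz: "norm (grad_x f z - grad_x f w) \<le> l * norm (z - w)"
  using grad_Lipschitz[of z w] norm_fst_le_norm[of "grad f z - grad f w"] by (simp add: grad_x_def)

text \<open>Strong concavity and smoothness in a single direction \<open>e\<close> already force \<open>\<mu> \<le> l\<close>.\<close>

lemma kappa_ge_1: "1 \<le> \<kappa>"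
proof -
  obtain e :: 'b where e: "e \<in> Basis" using nonempty_Basis by blast
  have "\<mu> * (norm e)\<^sup>2 \<le> (grad_y f (0, 0) - grad_y f (0, e)) \<bullet> (e - 0)"
    using grad_y_strongly_monotone[of 0 e 0] by (simp add: inner_diff_left)
  also have "\<dots> \<le> norm (grad_y f (0, 0) - grad_y f (0, e)) * norm (e - 0)"
    by (rule norm_cauchy_schwarz)
  also have "\<dots> \<le> (l * norm ((0, 0) - (0 :: 'a, e))) * norm (e - 0)"
    by (intro mult_right_mono grad_y_Lipschitz norm_ge_zero)
  finally have "\<mu> \<le> l" using e by (simp add: norm_Pair)
  then show ?thesis using pos by (simp add: kappa)
qed

lemma l_eq: "l = \<kappa> * \<mu>"
  using pos by (simp add: kappa)

text \<open>Infinitesimal form of the strong monotonicity of the \<open>y\<close>-gradient.\<close>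

lemma hess_yy_negative: "v \<bullet> hess_yy f z v \<le> - \<mu> * (norm v)\<^sup>2"
proof -
  obtain x y where z: "z = (x, y)" by (cases z)
  have small: "v \<bullet> hess_yy f z v + \<mu> * (norm v)\<^sup>2 \<le> t * (\<rho> / 2 * norm v ^ 3)" if t: "0 < t" for t
  proof -
    define w where "w = (0 :: 'a, t *\<^sub>R v)"
    define e where "e = grad f (z + w) - grad f z - hess f z w"
    have nw: "norm w = t * norm v" using t by (simp add: w_def norm_Pair)
    have "norm e \<le> \<rho> / 2 * (norm w)\<^sup>2"
      using grad_remainder[of "z + w" z] by (simp add: e_def)
    then have "norm e * norm w \<le> \<rho> / 2 * (norm w)\<^sup>2 * norm w"
      by (intro mult_right_mono) auto
    then have "- (e \<bullet> w) \<le> \<rho> / 2 * (norm w)\<^sup>2 * norm w"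
      using Cauchy_Schwarz_ineq2[of e w] by linarith
    moreover have "(grad f (z + w) - grad f z) \<bullet> w \<le> - \<mu> * (norm w)\<^sup>2"
      using grad_y_strongly_monotone[of x "y + t *\<^sub>R v" y] nw t
      by (simp add: w_def z inner_prod_def grad_y_def)
    ultimately have "hess f z w \<bullet> w + \<mu> * (norm w)\<^sup>2 \<le> \<rho> / 2 * (norm w)\<^sup>2 * norm w"
      by (simp add: e_def inner_diff_left)
    moreover have "hess f z w = t *\<^sub>R hess f z (0, v)"
      using linear_scale[OF linear_hess, of z t "(0, v)"] by (simp add: w_def)
    then have "hess f z w \<bullet> w = t\<^sup>2 * (v \<bullet> hess_yy f z v)"
      by (simp add: w_def inner_prod_def hess_yy_def inner_commute power2_eq_square)
    ultimately have "t\<^sup>2 * (v \<bullet> hess_yy f z v + \<mu> * (norm v)\<^sup>2) \<le> t\<^sup>2 * (t * (\<rho> / 2 * norm v ^ 3))"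
      unfolding nw by (simp add: power2_eq_square power3_eq_cube algebra_simps)
    then show ?thesis using t by simp
  qed
  have "v \<bullet> hess_yy f z v + \<mu> * (norm v)\<^sup>2 \<le> 0"
    by (rule le_if_vanishing_error[of _ _ "\<rho> / 2 * norm v ^ 3"]) (use small in simp)
  then show ?thesis by simp
qed

lemma hess_yy_lower_bound: "\<mu> * norm v \<le> norm (hess_yy f z v)"
proof (cases "v = 0")
  case False
  have "\<mu> * (norm v)\<^sup>2 \<le> - (v \<bullet> hess_yy f z v)" using hess_yy_negative[of v z] by simp
  also have "\<dots> \<le> norm v * norm (hess_yy f z v)"
    using Cauchy_Schwarz_ineq2[of v "hess_yy f z v"] by linarith
  finally have "norm v * (\<mu> * norm v) \<le> norm v * norm (hess_yy f z v)"
    by (simp add: power2_eq_square mult_ac)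
  then show ?thesis using False by simp
qed simp

lemma linear_hess_yy: "linear (hess_yy f z)"
proof (rule linearI)
  show "hess_yy f z (u + v) = hess_yy f z u + hess_yy f z v" for u v
    using linear_add[OF linear_hess, of z "(0, u)" "(0, v)"] by (simp add: hess_yy_def)
  show "hess_yy f z (c *\<^sub>R u) = c *\<^sub>R hess_yy f z u" for c u
    using linear_scale[OF linear_hess, of z c "(0, u)"] by (simp add: hess_yy_def)
qed

lemma inj_hess_yy: "inj (hess_yy f z)"
proof -
  have "v = 0" if "hess_yy f z v = 0" for v
    using hess_yy_lower_bound[of v z] that pos by (simp add: mult_le_0_iff)
  then show ?thesis using linear_injective_0[OF linear_hess_yy] by blast
qed

lemma surj_hess_yy: "surj (hess_yy f z)"
  using linear_inj_imp_surj[OF linear_hess_yy inj_hess_yy] .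

text \<open>The derivative of the inner maximiser: the change of \<open>y\<close> that compensates, to first order, the
  effect of a displacement \<open>u\<close> of \<open>x\<close> on the \<open>y\<close>-gradient.\<close>

definition response :: "'a \<times> 'b \<Rightarrow> 'a \<Rightarrow> 'b" where
  "response z u = - inv (hess_yy f z) (hess_yx f z u)"

lemma hess_yy_response: "hess_yy f z (response z u) = - hess_yx f z u"
  unfolding response_def
  by (simp add: linear_neg[OF linear_hess_yy] surj_f_inv_f[OF surj_hess_yy])

text \<open>Along response directions the full Hessian acts as the Schur complement. Every property of the
  Schur complement needed below is read off from this identity.\<close>

lemma hess_response: "hess f z (u, response z u) = (schur_hess f z u, 0)"
proof -
  have split: "hess f z (u, v) = hess f z (u, 0) + hess f z (0, v)" for v
    using linear_add[OF linear_hess, of z "(u, 0)" "(0, v)"] by simp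
  have "hess_xy f z (- v) = - hess_xy f z v" for v
    using linear_neg[OF linear_hess, of z "(0, v)"] by (simp add: hess_xy_def)
  moreover have "fst (hess f z (u, response z u)) = hess_xx f z u + hess_xy f z (response z u)"
    by (simp add: split[of "response z u"] hess_xx_def hess_xy_def)
  ultimately have "fst (hess f z (u, response z u)) = schur_hess f z u"
    by (simp add: schur_hess_def response_def)
  moreover have "snd (hess f z (u, response z u)) = 0"
    using hess_yy_response[of z u] by (simp add: split[of "response z u"] hess_yy_def hess_yx_def)
  ultimately show ?thesis by (simp add: prod_eq_iff)
qed

lemma norm_response: "norm (response z u) \<le> \<kappa> * norm u"
proof -
  have "\<mu> * norm (response z u) \<le> norm (hess_yx f z u)"
    using hess_yy_lower_bound[of "response z u" z] by (simp add: hess_yy_response)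
  also have "\<dots> \<le> norm (hess f z (u, 0))" by (simp add: hess_yx_def norm_snd_le_norm)
  also have "\<dots> \<le> l * norm u" using hess_bound[of z "(u, 0)"] by (simp add: norm_Pair)
  finally show ?thesis using pos by (simp add: kappa field_simps)
qed

lemma norm_Pair_kappa_le:
  assumes "norm v \<le> \<kappa> * norm u"
  shows "(norm (u, v))\<^sup>2 \<le> 2 * \<kappa>\<^sup>2 * (norm u)\<^sup>2"
proof -
  have "(norm v)\<^sup>2 \<le> (\<kappa> * norm u)\<^sup>2" using assms by (intro power_mono) auto
  moreover have "(norm u)\<^sup>2 \<le> \<kappa>\<^sup>2 * (norm u)\<^sup>2"
    using kappa_ge_1 by (intro mult_right_le_one_le[THEN order_trans] mult_le_cancel_right1[THEN iffD2]) auto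
  ultimately show ?thesis by (simp add: norm_Pair power_mult_distrib)
qed

lemma norm_Pair_kappa_le':
  assumes "norm v \<le> \<kappa> * norm u"
  shows "norm (u, v) \<le> sqrt 2 * \<kappa> * norm u"
proof (rule power2_le_imp_le)
  show "(norm (u, v))\<^sup>2 \<le> (sqrt 2 * \<kappa> * norm u)\<^sup>2"
    using norm_Pair_kappa_le[OF assms] by (simp add: power_mult_distrib)
qed (use kappa_ge_1 in simp)

lemma linear_response: "linear (response z)"
proof -
  have inj: "u = v" if "hess_yy f z u = hess_yy f z v" for u v
    using injD[OF inj_hess_yy that] .
  show ?thesis
  proof (rule linearI)
    show "response z (u + v) = response z u + response z v" for u v
      using linear_add[OF linear_hess, of z "(u, 0)" "(v, 0)"]
      by - (rule inj, simp add: linear_add[OF linear_hess_yy] hess_yy_response hess_yx_def)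
    show "response z (c *\<^sub>R u) = c *\<^sub>R response z u" for c u
      using linear_scale[OF linear_hess, of z c "(u, 0)"]
      by - (rule inj, simp add: linear_scale[OF linear_hess_yy] hess_yy_response hess_yx_def)
  qed
qed

lemma linear_schur_hess: "linear (schur_hess f z)"
proof -
  have eq: "schur_hess f z u = fst (hess f z (u, response z u))" for u
    by (simp add: hess_response)
  show ?thesis
  proof (rule linearI)
    show "schur_hess f z (u + v) = schur_hess f z u + schur_hess f z v" for u v
      using linear_add[OF linear_hess, of z "(u, response z u)" "(v, response z v)"]
      by (simp add: eq linear_add[OF linear_response])
    show "schur_hess f z (c *\<^sub>R u) = c *\<^sub>R schur_hess f z u" for c u
      using linear_scale[OF linear_hess, of z c "(u, response z u)"]
      by (simp add: eq linear_scale[OF linear_response])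
  qed
qed

lemma schur_hess_symmetric: "schur_hess f z v \<bullet> u = schur_hess f z u \<bullet> v"
  using hess_symmetric[of z "(v, response z v)" "(u, response z u)"]
  by (simp add: hess_response inner_prod_def)

lemma schur_hess_bound: "norm (schur_hess f z u) \<le> 2 * \<kappa> * l * norm u"
proof -
  have "norm (schur_hess f z u) = norm (hess f z (u, response z u))"
    by (simp add: hess_response norm_Pair)
  also have "\<dots> \<le> l * norm (u, response z u)" by (rule hess_bound)
  also have "norm (u, response z u) \<le> norm u + norm (response z u)"
    by (rule norm_Pair_le)
  also have "\<dots> \<le> \<kappa> * norm u + \<kappa> * norm u"
    using norm_response[of z u] kappa_ge_1 by (intro add_mono) (auto simp: mult_le_cancel_right1)
  finally show ?thesis using pos by (simp add: mult_ac)
qed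

text \<open>Both matrices are compared through the full Hessians \<open>F\<close>. Let \<open>q\<close> extend \<open>u\<close> by
  the response at \<open>z\<close> and \<open>p\<close> extend \<open>w\<close> by the response at \<open>z'\<close>. Then \<open>F(z) q\<close> and \<open>F(z') p\<close> have vanishing
  second component, and by symmetry of \<open>F(z')\<close> the form \<open>\<langle>p, (F(z) - F(z')) q\<rangle>\<close> is exactly
  \<open>\<langle>w, (H(z) - H(z')) u\<rangle>\<close>.\<close>

lemma schur_hess_Lipschitz:
  "norm (schur_hess f z u - schur_hess f z' u) \<le> 2 * \<kappa>\<^sup>2 * \<rho> * norm (z - z') * norm u"
proof -
  define w where "w = schur_hess f z u - schur_hess f z' u"
  define p where "p = (w, response z' w)"
  define q where "q = (u, response z u)"
  have "p \<bullet> hess f z q = w \<bullet> schur_hess f z u"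
    by (simp add: p_def q_def hess_response inner_prod_def)
  moreover have "p \<bullet> hess f z' q = w \<bullet> schur_hess f z' u"
  proof -
    have "p \<bullet> hess f z' q = hess f z' p \<bullet> q" using hess_symmetric[of z' q p] by (simp add: inner_commute)
    also have "\<dots> = schur_hess f z' w \<bullet> u" by (simp add: p_def q_def hess_response inner_prod_def)
    finally show ?thesis using schur_hess_symmetric[of z' w u] by (simp add: inner_commute)
  qed
  ultimately have "w \<bullet> w = p \<bullet> (hess f z q - hess f z' q)"
    by (simp add: inner_diff_right) (simp add: w_def inner_diff_right)
  then have "norm w * norm w = p \<bullet> (hess f z q - hess f z' q)"
    by (simp add: power2_norm_eq_inner flip: power2_eq_square)
  also have "\<dots> \<le> norm p * norm (hess f z q - hess f z' q)" by (rule norm_cauchy_schwarz)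
  also have "\<dots> \<le> norm p * (\<rho> * norm (z - z') * norm q)"
    by (intro mult_left_mono hess_Lipschitz norm_ge_zero)
  also have "\<dots> \<le> (sqrt 2 * \<kappa> * norm w) * (\<rho> * norm (z - z') * (sqrt 2 * \<kappa> * norm u))"
    using pos kappa_ge_1 unfolding p_def q_def
    by (intro mult_mono norm_Pair_kappa_le' norm_response) auto
  also have "\<dots> = norm w * (2 * \<kappa>\<^sup>2 * \<rho> * norm (z - z') * norm u)"
    by (simp add: power2_eq_square)
  finally show ?thesis using pos by (cases "w = 0") (auto simp: w_def)
qed

lemma GDERIV_in_y: "GDERIV (\<lambda>v. - f (x, v)) v :> - grad_y f (x, v)"
proof -
  have "((\<lambda>v. f (x, v)) has_derivative (\<lambda>k. (0, k) \<bullet> grad f (x, v))) (at v)"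
    using GDERIV_f[of "(x, v)"] unfolding gderiv_def
    by (rule has_derivative_compose[rotated]) (auto intro!: derivative_eq_intros)
  then have "GDERIV (\<lambda>v. f (x, v)) v :> grad_y f (x, v)"
    by (simp add: gderiv_def grad_y_def inner_prod_def)
  then show ?thesis by (rule GDERIV_minus)
qed

text \<open>Outside the ball of radius \<open>2 g / \<mu>\<close> strong concavity puts \<open>f (x, y)\<close> below \<open>f (x, 0)\<close>.\<close>

lemma inner_maximum_exists: "\<exists>v. \<forall>y. f (x, y) \<le> f (x, v)"
proof -
  define g where "g = norm (grad_y f (x, 0))"
  define R where "R = 2 * g / \<mu>"
  have R: "0 \<le> R" using pos by (simp add: R_def g_def)
  have "continuous_on UNIV f"
    using diff differentiable_imp_continuous_on unfolding twice_differentiable_def differentiable_on_def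
    by (metis differentiable_at_withinI)
  then have "continuous_on (cball 0 R) (\<lambda>v. f (x, v))"
    by (auto intro!: continuous_on_compose2[of UNIV f] continuous_intros)
  moreover have "cball 0 R \<noteq> ({} :: 'b set)" using R by simp
  ultimately obtain v where v: "v \<in> cball 0 R" "\<And>y. y \<in> cball 0 R \<Longrightarrow> f (x, y) \<le> f (x, v)"
    using continuous_attains_sup[of "cball 0 R" "\<lambda>v. f (x, v)"] compact_cball by blast
  have "f (x, y) \<le> f (x, v)" if y: "y \<notin> cball 0 R" for y
  proof -
    have "R \<le> norm y" using y by simp
    then have "g \<le> \<mu> / 2 * norm y" using pos by (simp add: R_def field_simps)
    then have "g * norm y \<le> \<mu> / 2 * norm y * norm y" by (intro mult_right_mono) auto
    moreover have "grad_y f (x, 0) \<bullet> y \<le> g * norm y" unfolding g_def by (rule norm_cauchy_schwarz)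
    ultimately have "f (x, y) \<le> f (x, 0)" using strong_concavity[of x y 0] by (simp add: power2_eq_square)
    also have "\<dots> \<le> f (x, v)" using R by (intro v(2)) simp
    finally show ?thesis .
  qed
  then show ?thesis using v by blast
qed

lemma y_star_maximum: "f (x, y) \<le> f (x, y_star f x)"
proof -
  have "is_arg_max (\<lambda>y. f (x, y)) (\<lambda>_. True) (y_star f x)"
    unfolding y_star_def arg_max_def
    by (rule someI_ex) (use inner_maximum_exists[of x] in \<open>simp add: is_arg_max_linorder\<close>)
  then show ?thesis by (simp add: is_arg_max_linorder)
qed

lemma primal_eq: "primal f x = f (x, y_star f x)"
  unfolding primal_def by (rule cSup_eq_maximum) (auto intro: y_star_maximum)

text \<open>A gradient step of length \<open>1/l\<close> from the maximiser would increase \<open>f\<close> by at least half of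
  \<open>norm g\<^sup>2 / l\<close>.\<close>

lemma grad_y_y_star: "grad_y f (x, y_star f x) = 0"
proof -
  define g where "g = grad_y f (x, y_star f x)"
  define w where "w = (0 :: 'a, (1 / l) *\<^sub>R g)"
  have "\<bar>f ((x, y_star f x) + w) - f (x, y_star f x) - grad f (x, y_star f x) \<bullet> w\<bar> \<le> l / 2 * (norm w)\<^sup>2"
    using descent_lemma[OF GDERIV_f grad_Lipschitz, of "(x, y_star f x) + w" "(x, y_star f x)"] by simp
  moreover have "f ((x, y_star f x) + w) \<le> f (x, y_star f x)"
    by (simp add: w_def y_star_maximum)
  moreover define c where "c = (norm g)\<^sup>2 / l"
  moreover have "grad f (x, y_star f x) \<bullet> w = c"
    by (simp add: c_def) (simp add: w_def inner_prod_def g_def grad_y_def power2_norm_eq_inner)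
  moreover have "l / 2 * (norm w)\<^sup>2 = c / 2"
    using pos by (simp add: c_def w_def norm_Pair power2_eq_square field_simps)
  ultimately have "(norm g)\<^sup>2 / l \<le> 0" unfolding c_def[symmetric] by linarith
  then show ?thesis using pos by (simp add: g_def divide_le_0_iff)
qed

text \<open>Strong monotonicity of the \<open>y\<close>-gradient at \<open>x'\<close> bounds the squared distance of the maximisers; of the two
  \<open>y\<close>-gradients at \<open>x'\<close>, one vanishes and the other differs from zero only by the change from \<open>x\<close> to \<open>x'\<close>.\<close>

lemma y_star_Lipschitz: "norm (y_star f x - y_star f x') \<le> \<kappa> * norm (x - x')"
proof (cases "y_star f x = y_star f x'")
  case False
  define d where "d = y_star f x - y_star f x'"
  have "\<mu> * (norm d)\<^sup>2 \<le> (grad_y f (x, y_star f x) - grad_y f (x', y_star f x)) \<bullet> d"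
    using grad_y_strongly_monotone[of x' "y_star f x" "y_star f x'"]
    by (simp add: d_def[symmetric] grad_y_y_star inner_diff_left)
  also have "\<dots> \<le> norm (grad_y f (x, y_star f x) - grad_y f (x', y_star f x)) * norm d"
    by (rule norm_cauchy_schwarz)
  also have "\<dots> \<le> (l * norm ((x, y_star f x) - (x', y_star f x))) * norm d"
    by (intro mult_right_mono grad_y_Lipschitz norm_ge_zero)
  finally have "(\<mu> * norm d) * norm d \<le> (l * norm (x - x')) * norm d"
    by (simp add: norm_Pair power2_eq_square mult_ac)
  then have "\<mu> * norm d \<le> l * norm (x - x')" using False by (simp add: d_def)
  then show ?thesis using pos by (simp add: d_def kappa field_simps)
qed (use kappa_ge_1 in simp)

lemma norm_Pair_y_star: "norm ((x, y_star f x) - (x', y_star f x')) \<le> sqrt 2 * \<kappa> * norm (x - x')"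
  using norm_Pair_kappa_le'[OF y_star_Lipschitz] by simp

text \<open>The first-order expansion of \<open>f\<close> between two points of the curve \<open>(x, y*(x))\<close> has no \<open>y\<close>-term, and its
  quadratic remainder is quadratic in the displacement of \<open>x\<close>, because the curve is Lipschitz.\<close>

lemma GDERIV_primal: "GDERIV (primal f) x :> grad_x f (x, y_star f x)"
  unfolding gderiv_def
proof (rule has_derivative_quadratic_remainder)
  show "bounded_linear (\<lambda>h. h \<bullet> grad_x f (x, y_star f x))" by (rule bounded_linear_inner_left)
  fix w
  let ?z = "(x, y_star f x)" and ?w = "(w, y_star f w)"
  have "grad f ?z \<bullet> (?w - ?z) = (w - x) \<bullet> grad_x f ?z"
    using grad_y_y_star[of x] by (simp add: inner_prod_def grad_x_def grad_y_def inner_commute)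
  then have "norm (primal f w - primal f x - (w - x) \<bullet> grad_x f ?z) \<le> l / 2 * (norm (?w - ?z))\<^sup>2"
    using descent_lemma[OF GDERIV_f grad_Lipschitz, of ?w ?z] by (simp add: primal_eq)
  also have "\<dots> \<le> l / 2 * (sqrt 2 * \<kappa> * norm (w - x))\<^sup>2"
    using pos by (intro mult_left_mono power_mono norm_Pair_y_star) auto
  finally show "norm (primal f w - primal f x - (w - x) \<bullet> grad_x f ?z) \<le> l * \<kappa>\<^sup>2 * (norm (w - x))\<^sup>2"
    by (simp add: power_mult_distrib)
qed

lemma grad_primal: "grad (primal f) = (\<lambda>x. grad_x f (x, y_star f x))"
  using grad_eqI[OF GDERIV_primal] by blast

text \<open>The \<open>y\<close>-component of the expansion of the gradient of \<open>f\<close> between two points of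
  the curve says that the actual displacement \<open>v\<close> of the maximiser equals the linear response up to a
  quadratic error, and substituting this in the \<open>x\<close>-component gives the Schur complement.\<close>

lemma has_derivative_grad_primal:
  "(grad (primal f) has_derivative schur_hess f (x, y_star f x)) (at x)"
proof (rule has_derivative_quadratic_remainder)
  show "bounded_linear (schur_hess f (x, y_star f x))"
    using linear_schur_hess linear_conv_bounded_linear by blast
  fix w
  define z where "z = (x, y_star f x)"
  define u where "u = w - x"
  define v where "v = y_star f w - y_star f x"
  define e where "e = grad f (w, y_star f w) - grad f z - hess f z (u, v)"
  have d: "(w, y_star f w) - z = (u, v)" by (simp add: z_def u_def v_def)
  have e: "norm e \<le> \<rho> / 2 * (norm (u, v))\<^sup>2"
    using grad_remainder[of "(w, y_star f w)" z] unfolding d e_def .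
  have uv: "hess f z (u, v) = (schur_hess f z u, 0) + hess f z (0, v - response z u)"
    using linear_add[OF linear_hess, of z "(u, response z u)" "(0, v - response z u)"]
    by (simp add: hess_response)
  have "grad_y f z = 0" by (simp add: z_def grad_y_y_star)
  then have snd_e: "snd e = - hess_yy f z (v - response z u)"
    using grad_y_y_star[of w] by (simp add: e_def uv hess_yy_def grad_y_def)
  have fst_e: "grad_x f (w, y_star f w) - grad_x f z - schur_hess f z u
      = fst e + fst (hess f z (0, v - response z u))"
    by (simp add: e_def uv grad_x_def)
  have "\<mu> * norm (v - response z u) \<le> norm e"
    using hess_yy_lower_bound[of "v - response z u" z] norm_snd_le_norm[of e] by (simp add: snd_e)
  then have gap: "norm (v - response z u) \<le> norm e / \<mu>" using pos by (simp add: field_simps)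
  have "norm (grad_x f (w, y_star f w) - grad_x f z - schur_hess f z u)
      \<le> norm (fst e) + norm (fst (hess f z (0, v - response z u)))"
    unfolding fst_e by (rule norm_triangle_ineq)
  also have "\<dots> \<le> norm e + l * (norm e / \<mu>)"
  proof (rule add_mono[OF norm_fst_le_norm])
    have "norm (fst (hess f z (0, v - response z u))) \<le> l * norm (v - response z u)"
      using norm_fst_le_norm[of "hess f z (0, v - response z u)"] hess_bound[of z "(0, v - response z u)"]
      by (simp add: norm_Pair)
    also have "\<dots> \<le> l * (norm e / \<mu>)" using gap pos by (intro mult_left_mono) auto
    finally show "norm (fst (hess f z (0, v - response z u))) \<le> l * (norm e / \<mu>)" .
  qed
  also have "\<dots> = (1 + \<kappa>) * norm e" by (simp add: kappa algebra_simps)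
  also have "\<dots> \<le> (1 + \<kappa>) * (\<rho> / 2 * (2 * \<kappa>\<^sup>2 * (norm u)\<^sup>2))"
  proof (rule mult_left_mono)
    have "norm v \<le> \<kappa> * norm u" using y_star_Lipschitz by (simp add: u_def v_def)
    then have "\<rho> / 2 * (norm (u, v))\<^sup>2 \<le> \<rho> / 2 * (2 * \<kappa>\<^sup>2 * (norm u)\<^sup>2)"
      using pos by (intro mult_left_mono norm_Pair_kappa_le) auto
    then show "norm e \<le> \<rho> / 2 * (2 * \<kappa>\<^sup>2 * (norm u)\<^sup>2)" using e by linarith
  qed (use kappa_ge_1 in simp)
  finally show "norm (grad (primal f) w - grad (primal f) x - schur_hess f (x, y_star f x) (w - x))
      \<le> ((1 + \<kappa>) * \<rho> * \<kappa>\<^sup>2) * (norm (w - x))\<^sup>2"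
    unfolding grad_primal z_def u_def by (simp add: mult_ac)
qed

lemma hess_primal: "hess (primal f) x = schur_hess f (x, y_star f x)"
  using frechet_derivative_at[OF has_derivative_grad_primal] by (simp add: hess_def)

lemma twice_differentiable_primal: "twice_differentiable (primal f)"
  using GDERIV_primal has_derivative_grad_primal
  unfolding twice_differentiable_def gderiv_def differentiable_def by blast

lemma hess_primal_Lipschitz:
  "norm (hess (primal f) v e - hess (primal f) w e) \<le> 2 * sqrt 2 * \<kappa> ^ 3 * \<rho> * norm (v - w) * norm e"
proof -
  have "norm (hess (primal f) v e - hess (primal f) w e)
      \<le> 2 * \<kappa>\<^sup>2 * \<rho> * norm ((v, y_star f v) - (w, y_star f w)) * norm e"
    unfolding hess_primal by (rule schur_hess_Lipschitz)
  also have "\<dots> \<le> 2 * \<kappa>\<^sup>2 * \<rho> * (sqrt 2 * \<kappa> * norm (v - w)) * norm e"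
    using pos by (intro mult_right_mono mult_left_mono norm_Pair_y_star) auto
  finally show ?thesis by (simp add: power2_eq_square power3_eq_cube mult_ac)
qed

lemma agd_inner_accuracy:
  assumes tol: "0 < tol" and D: "norm (y0 - y_star f x) \<le> D"
    and K: "2 * sqrt \<kappa> * ln (sqrt (\<kappa> + 1) / tol * D) \<le> real_of_int K"
  shows "norm (agd (\<lambda>v. - f (x, v)) y0 K (1 / l) ((sqrt \<kappa> - 1) / (sqrt \<kappa> + 1)) - y_star f x) \<le> tol"
proof (rule agd_accuracy[OF GDERIV_in_y _ _ pos(3) kappa_ge_1 l_eq _ tol D K])
  show "norm (- grad_y f (x, v) - - grad_y f (x, w)) \<le> l * norm (v - w)" for v w
    using grad_y_Lipschitz[of "(x, v)" "(x, w)"] by (simp add: norm_minus_commute norm_Pair)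
  show "- f (x, w) + - grad_y f (x, w) \<bullet> (v - w) + \<mu> / 2 * (norm (v - w))\<^sup>2 \<le> - f (x, v)" for v w
    using strong_concavity[of x v w] by simp
  show "- grad_y f (x, y_star f x) = 0" by (simp add: grad_y_y_star)
qed

end

section \<open>Minimisers of the cubic model\<close>

text \<open>\<open>p\<^sup>3 - q\<^sup>3\<close> exceeds its linearisation in the variable \<open>p\<^sup>2\<close> by exactly \<open>(p - q)\<^sup>2 (p + q/2)\<close>.\<close>

lemma cube_increment_bound:
  fixes p q b :: real
  assumes "0 \<le> p" "0 \<le> q" "\<bar>p - q\<bar> \<le> b"
  shows "p ^ 3 - q ^ 3 \<le> 3 / 2 * q * (p\<^sup>2 - q\<^sup>2) + b\<^sup>2 * (3 / 2 * q + b)"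
proof -
  have "p ^ 3 - q ^ 3 = 3 / 2 * q * (p\<^sup>2 - q\<^sup>2) + (p - q)\<^sup>2 * (p + q / 2)"
    by (simp add: power2_eq_square power3_eq_cube algebra_simps diff_divide_distrib)
  moreover have "(p - q)\<^sup>2 * (p + q / 2) \<le> b\<^sup>2 * (3 / 2 * q + b)"
  proof (rule mult_mono)
    show "(p - q)\<^sup>2 \<le> b\<^sup>2" using assms by (metis abs_ge_zero power2_abs power_mono)
  qed (use assms in auto)
  ultimately show ?thesis by simp
qed

text \<open>A second-order expansion of the cubed norm that is uniform in \<open>s\<close>, including \<open>s = 0\<close>, where the norm is not
  differentiable.\<close>

lemma norm_cubed_increment_bound:
  fixes s e :: "'a::real_inner"
  shows "norm (s + e) ^ 3 - norm s ^ 3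
    \<le> 3 * norm s * (s \<bullet> e) + (norm e)\<^sup>2 * (3 * norm s + norm e)"
proof -
  have "norm (s + e) ^ 3 - norm s ^ 3 \<le> 3 / 2 * norm s * ((norm (s + e))\<^sup>2 - (norm s)\<^sup>2)
      + (norm e)\<^sup>2 * (3 / 2 * norm s + norm e)"
    using norm_triangle_ineq3[of "s + e" s] by (intro cube_increment_bound) auto
  also have "(norm (s + e))\<^sup>2 - (norm s)\<^sup>2 = 2 * (s \<bullet> e) + (norm e)\<^sup>2"
    by (simp add: power2_norm_eq_inner inner_add_left inner_add_right inner_commute)
  finally show ?thesis by (simp add: algebra_simps)
qed

locale cubic_minimizer =
  fixes g :: "'a::euclidean_space" and H :: "'a \<Rightarrow> 'a" and M :: real and s :: 'a
  assumes linear: "linear H" and symmetric: "\<And>u v. H u \<bullet> v = H v \<bullet> u" and M: "0 < M"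
    and minimal: "\<And>w. cubic_model g H M s \<le> cubic_model g H M w"
begin

lemma model_increment:
  "cubic_model g H M (s + e) - cubic_model g H M s
    \<le> (g + H s + (M / 2 * norm s) *\<^sub>R s) \<bullet> e + 1/2 * (e \<bullet> H e) + M / 6 * ((norm e)\<^sup>2 * (3 * norm s + norm e))"
proof -
  have "M / 6 * (norm (s + e) ^ 3 - norm s ^ 3)
      \<le> M / 6 * (3 * norm s * (s \<bullet> e) + (norm e)\<^sup>2 * (3 * norm s + norm e))"
    using M by (intro mult_left_mono norm_cubed_increment_bound) auto
  moreover have "(s + e) \<bullet> H (s + e) = s \<bullet> H s + 2 * (H s \<bullet> e) + e \<bullet> H e"
    using symmetric[of e s]
    by (simp add: linear_add[OF linear] inner_add_left inner_add_right inner_commute)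
  ultimately show ?thesis
    by (simp add: cubic_model_def inner_add_left inner_add_right algebra_simps)
qed

lemma stationary: "g + H s + (M / 2 * norm s) *\<^sub>R s = 0"
proof -
  define G where "G = g + H s + (M / 2 * norm s) *\<^sub>R s"
  define c where "c = 1/2 * (G \<bullet> H G) + M / 6 * ((norm G)\<^sup>2 * (3 * norm s + norm G))"
  have "G \<bullet> G \<le> 0 + t * c" if t: "0 < t" "t \<le> 1" for t
  proof -
    \<comment> \<open>a short step against the model gradient \<open>G\<close>\<close>
    let ?e = "- (t *\<^sub>R G)"
    have "0 \<le> G \<bullet> ?e + 1/2 * (?e \<bullet> H ?e) + M / 6 * ((norm ?e)\<^sup>2 * (3 * norm s + norm ?e))"
      using model_increment[of ?e] minimal[of "s + ?e"] by (simp add: G_def)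
    also have "?e \<bullet> H ?e = t\<^sup>2 * (G \<bullet> H G)"
      by (simp add: linear_neg[OF linear] linear_scale[OF linear] power2_eq_square)
    also have "M / 6 * ((norm ?e)\<^sup>2 * (3 * norm s + norm ?e)) \<le> t\<^sup>2 * (M / 6 * ((norm G)\<^sup>2 * (3 * norm s + norm G)))"
    proof -
      have "norm ?e \<le> norm G" using t by (simp add: mult_left_le_one_le)
      then have "M / 6 * ((norm ?e)\<^sup>2 * (3 * norm s + norm ?e)) \<le> M / 6 * ((norm ?e)\<^sup>2 * (3 * norm s + norm G))"
        using M by (intro mult_left_mono) auto
      then show ?thesis using t by (simp add: power_mult_distrib mult_ac)
    qed
    finally have "t * (G \<bullet> G) \<le> t * (t * c)"
      by (simp add: c_def power2_eq_square algebra_simps)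
    then show ?thesis using t by simp
  qed
  then have "G \<bullet> G \<le> 0" by (rule le_if_vanishing_error)
  then have "G = 0" by (metis inner_gt_zero_iff not_less)
  then show ?thesis by (simp only: G_def)
qed

text \<open>At a stationary point the bound on the model increment has no linear term, so minimality makes the quadratic form
  of \<open>H\<close> plus the second-order part of the bound for the cubed norm nonnegative.\<close>

lemma curvature_lower_bound: "- (M * norm s) * (norm v)\<^sup>2 \<le> v \<bullet> H v"
proof -
  have "- (M * norm s) * (norm v)\<^sup>2 \<le> v \<bullet> H v + t * (M / 3 * norm v ^ 3)" if t: "0 < t" "t \<le> 1" for t
  proof -
    let ?e = "t *\<^sub>R v"
    have "0 \<le> 1/2 * (?e \<bullet> H ?e) + M / 6 * ((norm ?e)\<^sup>2 * (3 * norm s + norm ?e))"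
      using model_increment[of ?e] minimal[of "s + ?e"] unfolding stationary by simp
    also have "\<dots> = t\<^sup>2 / 2 * (v \<bullet> H v + M * norm s * (norm v)\<^sup>2 + t * (M / 3 * norm v ^ 3))"
      using t by (simp add: linear_scale[OF linear] power2_eq_square power3_eq_cube algebra_simps)
    finally show ?thesis using t by (simp add: zero_le_mult_iff)
  qed
  then show ?thesis by (rule le_if_vanishing_error)
qed

text \<open>Comparison with \<open>- s\<close> gives \<open>g \<bullet> s \<le> 0\<close>, and stationarity tested with \<open>s\<close> eliminates the quadratic
  term of the model.\<close>

lemma model_decrease: "cubic_model g H M s \<le> - M / 12 * norm s ^ 3"
proof -
  have "g \<bullet> s \<le> 0"
    using minimal[of "- s"] by (simp add: cubic_model_def linear_neg[OF linear])
  moreover have "g \<bullet> s + s \<bullet> H s + M / 2 * norm s ^ 3 = 0"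
  proof -
    have "(g + H s + (M / 2 * norm s) *\<^sub>R s) \<bullet> s = 0" unfolding stationary by simp
    then have "g \<bullet> s + H s \<bullet> s + (M / 2 * norm s) * (s \<bullet> s) = 0"
      by (simp add: inner_add_left)
    then show ?thesis
      by (simp add: dot_square_norm inner_commute power2_eq_square power3_eq_cube mult.assoc)
  qed
  ultimately show ?thesis unfolding cubic_model_def by linarith
qed

end

text \<open>One step of the cubic Newton method for \<open>P\<close> with an inexact gradient \<open>g\<close> and Hessian \<open>H\<close>; \<open>r\<close> is the length scale for
  which the target accuracies are \<open>M r\<^sup>2\<close> for the gradient and \<open>M r\<close> for the curvature. The Hessian of \<open>P\<close> is
  \<open>M/2\<close>-Lipschitz, although the model uses \<open>M\<close>: this slack pays for the comparatively large Hessian error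
  \<open>M r / 10\<close>.\<close>

locale inexact_cubic_step = cubic_minimizer g H M s
  for g :: "'a::euclidean_space" and H :: "'a \<Rightarrow> 'a" and M :: real and s :: 'a +
  fixes P :: "'a \<Rightarrow> real" and D :: "'a \<Rightarrow> 'a \<Rightarrow> 'a" and x :: 'a and r :: real
  assumes GDERIV_P: "\<And>w. GDERIV P w :> grad P w"
    and D: "\<And>w. (grad P has_derivative D w) (at w)"
    and Lip: "\<And>v w e. norm (D v e - D w e) \<le> M / 2 * norm (v - w) * norm e"
    and r: "0 < r"
    and g_error: "norm (g - grad P x) \<le> M * r\<^sup>2 / 192"
    and H_error: "\<And>u. norm (H u - D x u) \<le> M * r / 10 * norm u"
begin

text \<open>With \<open>n = norm s \<ge> r/2\<close>, the model and the slack in \<open>M\<close> contribute \<open>- M n\<^sup>3 / 6\<close>, the gradient error at most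
  \<open>M n\<^sup>3 / 48\<close> and the Hessian error at most \<open>M n\<^sup>3 / 10\<close>.\<close>

lemma long_step_decrease:
  assumes "r / 2 \<le> norm s"
  shows "P (x + s) \<le> P x - M / 24 * norm s ^ 3"
proof -
  define n where "n = norm s"
  have n: "0 \<le> n" "r \<le> 2 * n" using assms by (auto simp: n_def)
  have "P (x + s) \<le> P x + grad P x \<bullet> s + 1/2 * (s \<bullet> D x s) + M / 2 / 6 * n ^ 3"
    unfolding n_def by (rule cubic_taylor_upper_bound[OF GDERIV_P D Lip])
  moreover have "(grad P x - g) \<bullet> s \<le> M * r\<^sup>2 / 192 * n"
  proof -
    have "(grad P x - g) \<bullet> s \<le> norm (grad P x - g) * norm s" by (rule norm_cauchy_schwarz)
    also have "\<dots> \<le> M * r\<^sup>2 / 192 * n"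
      unfolding n_def norm_minus_commute[of "grad P x"] by (intro mult_right_mono g_error) simp
    finally show ?thesis .
  qed
  moreover have "s \<bullet> (D x s - H s) \<le> M * r / 10 * n\<^sup>2"
  proof -
    have "s \<bullet> (D x s - H s) \<le> norm s * norm (D x s - H s)" by (rule norm_cauchy_schwarz)
    also have "\<dots> \<le> norm s * (M * r / 10 * norm s)"
      unfolding norm_minus_commute[of "D x s"] by (intro mult_left_mono H_error) simp
    finally show ?thesis by (simp add: n_def power2_eq_square mult_ac)
  qed
  moreover have "cubic_model g H M s \<le> - M / 12 * n ^ 3"
    unfolding n_def by (rule model_decrease)
  moreover have "M * r\<^sup>2 / 192 * n \<le> M / 48 * n ^ 3"
  proof -
    have "r\<^sup>2 \<le> (2 * n)\<^sup>2" using n r by (intro power_mono) auto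
    then have "M / 192 * n * r\<^sup>2 \<le> M / 192 * n * (2 * n)\<^sup>2"
      using M n by (intro mult_left_mono) auto
    then show ?thesis by (simp add: power2_eq_square power3_eq_cube mult_ac)
  qed
  moreover have "M * r / 10 * n\<^sup>2 \<le> M / 5 * n ^ 3"
  proof -
    have "M / 10 * n\<^sup>2 * r \<le> M / 10 * n\<^sup>2 * (2 * n)" using M n by (intro mult_left_mono) auto
    then show ?thesis by (simp add: power2_eq_square power3_eq_cube mult_ac)
  qed
  moreover have "0 \<le> M * n ^ 3" using M n by simp
  ultimately show ?thesis
    unfolding n_def[symmetric] cubic_model_def
    by (simp add: inner_diff_left inner_diff_right algebra_simps)
qed

lemma short_step_gradient:
  assumes "norm s \<le> r / 2"
  shows "norm (grad P (x + s)) \<le> M * r\<^sup>2"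
proof -
  define n where "n = norm s"
  have n: "0 \<le> n" "n \<le> r / 2" using assms by (auto simp: n_def)
  define e where "e = grad P (x + s) - grad P x - D x s"
  have eq: "grad P (x + s) = e - (g - grad P x) - (H s - D x s) - (M / 2 * norm s) *\<^sub>R s"
    using stationary by (simp add: e_def algebra_simps eq_neg_iff_add_eq_0)
  have "norm (grad P (x + s)) \<le> norm e + norm (g - grad P x) + norm (H s - D x s) + norm ((M / 2 * norm s) *\<^sub>R s)"
    unfolding eq using norm_triangle_ineq4[of "e - (g - grad P x) - (H s - D x s)" "(M / 2 * norm s) *\<^sub>R s"]
      norm_triangle_ineq4[of "e - (g - grad P x)" "H s - D x s"] norm_triangle_ineq4[of e "g - grad P x"]
    by linarith
  moreover have "norm e \<le> M / 2 / 2 * n\<^sup>2"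
    using derivative_taylor_bound[OF D Lip, of "x + s" x] by (simp add: e_def n_def)
  moreover have "norm (H s - D x s) \<le> M * r / 10 * n" unfolding n_def by (rule H_error)
  moreover have "norm ((M / 2 * norm s) *\<^sub>R s) = M / 2 * n\<^sup>2"
    using M by (simp add: n_def power2_eq_square)
  moreover have "M * n\<^sup>2 \<le> M * r\<^sup>2 / 4"
  proof -
    have "n\<^sup>2 \<le> (r / 2)\<^sup>2" using n by (intro power_mono) auto
    then have "M * n\<^sup>2 \<le> M * (r / 2)\<^sup>2" using M by (intro mult_left_mono) auto
    then show ?thesis by (simp add: power_divide)
  qed
  moreover have "M * r / 10 * n \<le> M * r\<^sup>2 / 20"
  proof -
    have "M * r / 10 * n \<le> M * r / 10 * (r / 2)" using M r n by (intro mult_left_mono) auto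
    then show ?thesis by (simp add: power2_eq_square)
  qed
  moreover have "0 \<le> M * r\<^sup>2" using M by simp
  ultimately show ?thesis using g_error by linarith
qed

lemma short_step_curvature:
  assumes "norm s \<le> r / 2"
  shows "- (M * r) * (v \<bullet> v) \<le> v \<bullet> D (x + s) v"
proof -
  define n where "n = norm s"
  have n: "n \<le> r / 2" using assms by (simp add: n_def)
  have err: "\<bar>v \<bullet> w\<bar> \<le> c * (norm v)\<^sup>2" if "norm w \<le> c * norm v" for w c
  proof -
    have "\<bar>v \<bullet> w\<bar> \<le> norm v * norm w" by (rule Cauchy_Schwarz_ineq2)
    also have "\<dots> \<le> norm v * (c * norm v)" by (intro mult_left_mono that) simp
    finally show ?thesis by (simp add: power2_eq_square mult_ac)
  qed
  have "\<bar>v \<bullet> (D (x + s) v - D x v)\<bar> \<le> M / 2 * n * (norm v)\<^sup>2"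
    by (rule err) (use Lip[of "x + s" v x] in \<open>simp add: n_def\<close>)
  moreover have "\<bar>v \<bullet> (H v - D x v)\<bar> \<le> M * r / 10 * (norm v)\<^sup>2"
    by (rule err) (rule H_error)
  moreover have "- (M * n) * (norm v)\<^sup>2 \<le> v \<bullet> H v"
    unfolding n_def by (rule curvature_lower_bound)
  moreover have "M * n * (norm v)\<^sup>2 \<le> M * (r / 2) * (norm v)\<^sup>2"
    using n M by (intro mult_right_mono mult_left_mono) auto
  moreover have "0 \<le> M * r * (norm v)\<^sup>2" using M r by simp
  ultimately have "- (M * r) * (norm v)\<^sup>2 \<le> v \<bullet> D (x + s) v"
    unfolding inner_diff_right abs_le_iff by (simp add: algebra_simps)
  then show ?thesis by (simp add: power2_norm_eq_inner)
qed

end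

section \<open>Correctness of the minimax cubic Newton method\<close>

text \<open>A complete run of the method: \<open>tol\<close> is the tolerance of the outer loop, \<open>acc\<close> that of the
  inner maximisation, \<open>r\<close> the length scale of the cubic step, and \<open>Pinf\<close> any lower bound of the maximum function.\<close>

locale mcn_execution = strongly_concave_minimax f l \<rho> \<mu> \<kappa>
  for f :: "'a::euclidean_space \<times> 'b::euclidean_space \<Rightarrow> real" and l \<rho> \<mu> \<kappa> :: real +
  fixes tol M r acc Pinf :: real and x0 :: 'a and T N :: nat and K :: "nat \<Rightarrow> int"
    and x s :: "nat \<Rightarrow> 'a" and y :: "nat \<Rightarrow> 'b"
  assumes M: "M = 4 * sqrt 2 * \<kappa> ^ 3 * \<rho>"
    and tol: "0 < tol"
    and r_def: "r = sqrt (tol / M)"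
    and acc: "acc = min (1 / 192 * tol / l) (1 / 48 * sqrt (M * tol) / \<rho>)"
    and lower: "\<And>w. Pinf \<le> primal f w"
    and T: "T = nat (\<lceil>192 * (primal f x0 - Pinf) * sqrt M * tol powr (-1.5)\<rceil> + 1)"
    and K_0: "K 0 = \<lceil>2 * sqrt \<kappa> * ln (sqrt (\<kappa> + 1) / acc * norm (y_star f x0))\<rceil>"
    and K_Suc: "\<And>t. Suc t < N \<Longrightarrow>
       K (Suc t) = \<lceil>2 * sqrt \<kappa> * ln (sqrt (\<kappa> + 1) / acc * (acc + \<kappa> * norm (s t)))\<rceil>"
    and run: "mcn_run f l \<kappa> M tol T K x0 x y s N"
begin

lemma run_facts:
  shows N_pos: "1 \<le> N" and N_le_T: "N \<le> T" and x_0: "x 0 = x0"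
    and y_eq: "t < N \<Longrightarrow> y t = agd (\<lambda>v. - f (x t, v)) (if t = 0 then 0 else y (t - 1)) (K t)
                    (1 / l) ((sqrt \<kappa> - 1) / (sqrt \<kappa> + 1))"
    and s_minimal: "t < N \<Longrightarrow> is_arg_min (cubic_model (grad_x f (x t, y t)) (schur_hess f (x t, y t)) M)
                (\<lambda>_. True) (s t)"
    and s_long: "Suc t < N \<Longrightarrow> \<not> norm (s t) \<le> 1/2 * sqrt (tol / M)"
    and x_Suc: "Suc t < N \<Longrightarrow> x (Suc t) = x t + s t"
    and stopped: "N = T \<or> norm (s (N - 1)) \<le> 1/2 * sqrt (tol / M)"
  using run unfolding mcn_run_def by blast+

lemma M_pos: "0 < M"
  using pos kappa_ge_1 by (simp add: M)

lemma M_ge: "5 * \<kappa> ^ 3 * \<rho> \<le> M"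
proof -
  \<comment> \<open>the only property of \<open>4 sqrt 2\<close> used for the Hessian error: it is at least 5\<close>
  have "5 / 4 \<le> sqrt 2" by (rule real_le_rsqrt) (simp add: power2_eq_square)
  then have "5 * (\<kappa> ^ 3 * \<rho>) \<le> (4 * sqrt 2) * (\<kappa> ^ 3 * \<rho>)"
    using pos kappa_ge_1 by (intro mult_right_mono) auto
  then show ?thesis by (simp add: M mult.assoc)
qed

lemma r_pos: "0 < r"
  using tol M_pos by (simp add: r_def)

lemma tol_eq: "tol = M * r\<^sup>2"
  using tol M_pos by (simp add: r_def)

lemma sqrt_M_tol: "sqrt (M * tol) = M * r"
proof (rule real_sqrt_unique)
  show "(M * r)\<^sup>2 = M * tol" by (simp add: tol_eq power2_eq_square)
qed (use M_pos r_pos in simp)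

lemma acc_pos: "0 < acc"
  using tol M_pos pos by (simp add: acc)

text \<open>The starting point of an inner run is the previous inner result, whose distance to the new maximiser is at
  most \<open>acc + \<kappa> norm (s t)\<close>; this is the quantity in the prescribed number of steps.\<close>

lemma inner_accuracy: "t < N \<Longrightarrow> norm (y t - y_star f (x t)) \<le> acc"
proof (induction t)
  case 0
  have "norm (agd (\<lambda>v. - f (x 0, v)) 0 (K 0) (1 / l) ((sqrt \<kappa> - 1) / (sqrt \<kappa> + 1)) - y_star f (x 0)) \<le> acc"
    by (rule agd_inner_accuracy[OF acc_pos, of _ _ "norm (y_star f x0)"]) (simp_all add: x_0 K_0)
  then show ?case using y_eq[OF 0] by simp
next
  case (Suc t)
  have "norm (y t - y_star f (x (Suc t))) \<le> norm (y t - y_star f (x t)) + norm (y_star f (x t) - y_star f (x (Suc t)))"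
    using norm_triangle_ineq[of "y t - y_star f (x t)" "y_star f (x t) - y_star f (x (Suc t))"] by simp
  also have "\<dots> \<le> acc + \<kappa> * norm (x t - x (Suc t))"
    using Suc y_star_Lipschitz by (intro add_mono) auto
  also have "norm (x t - x (Suc t)) = norm (s t)" using x_Suc[OF Suc.prems] by simp
  finally have "norm (agd (\<lambda>v. - f (x (Suc t), v)) (y t) (K (Suc t)) (1 / l) ((sqrt \<kappa> - 1) / (sqrt \<kappa> + 1))
      - y_star f (x (Suc t))) \<le> acc"
    by (rule agd_inner_accuracy[OF acc_pos]) (use K_Suc[OF Suc.prems] in simp)
  then show ?case using y_eq[OF Suc.prems] by simp
qed

lemma gradient_error:
  assumes "t < N"
  shows "norm (grad_x f (x t, y t) - grad (primal f) (x t)) \<le> M * r\<^sup>2 / 192"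
proof -
  have "norm (grad_x f (x t, y t) - grad (primal f) (x t)) \<le> l * norm ((x t, y t) - (x t, y_star f (x t)))"
    unfolding grad_primal by (rule grad_x_Lipschitz)
  also have "\<dots> \<le> l * acc"
    using inner_accuracy[OF assms] pos by (simp add: norm_Pair)
  also have "\<dots> \<le> l * (1 / 192 * tol / l)"
    using pos by (intro mult_left_mono) (simp_all add: acc)
  finally show ?thesis using pos by (simp add: tol_eq)
qed

text \<open>The error is at most \<open>2\<kappa>\<^sup>2\<rho> acc\<close> and also at most \<open>4\<kappa>l\<close>. Since \<open>acc \<le> tol / (192 l)\<close> and
  \<open>5\<kappa>\<^sup>3\<rho> \<le> M\<close>, the former is at most \<open>(M r)\<^sup>2 / (480 \<kappa> l)\<close>. The threshold \<open>M r = 40 \<kappa> l\<close> makes one of the two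
  bounds good enough.\<close>

lemma hessian_error:
  assumes "t < N"
  shows "norm (schur_hess f (x t, y t) u - hess (primal f) (x t) u) \<le> M * r / 10 * norm u"
proof (cases "M * r \<le> 40 * \<kappa> * l")
  case True
  have k: "0 < \<kappa>" using kappa_ge_1 by simp
  have "norm (schur_hess f (x t, y t) u - hess (primal f) (x t) u)
      \<le> 2 * \<kappa>\<^sup>2 * \<rho> * norm ((x t, y t) - (x t, y_star f (x t))) * norm u"
    unfolding hess_primal by (rule schur_hess_Lipschitz)
  also have "\<dots> \<le> 2 * \<kappa>\<^sup>2 * \<rho> * acc * norm u"
    using inner_accuracy[OF assms] pos
    by (intro mult_right_mono mult_left_mono) (simp_all add: norm_Pair)
  also have "\<dots> \<le> M * r / 10 * norm u"
  proof (rule mult_right_mono)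
    have "2 * \<kappa>\<^sup>2 * \<rho> * acc \<le> 2 * \<kappa>\<^sup>2 * \<rho> * (1 / 192 * tol / l)"
      using pos by (intro mult_left_mono) (simp_all add: acc)
    also have "\<dots> = (5 * \<kappa> ^ 3 * \<rho>) * (M * r\<^sup>2) / (480 * \<kappa> * l)"
      using k pos by (simp add: tol_eq power2_eq_square power3_eq_cube)
    also have "\<dots> \<le> M * (M * r\<^sup>2) / (480 * \<kappa> * l)"
      using k pos M_pos by (intro divide_right_mono mult_right_mono M_ge) auto
    also have "\<dots> = (M * r) * (M * r) / (480 * \<kappa> * l)" by (simp add: power2_eq_square)
    also have "\<dots> \<le> (40 * \<kappa> * l) * (M * r) / (480 * \<kappa> * l)"
      using True M_pos r_pos k pos by (intro divide_right_mono mult_right_mono) auto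
    also have "\<dots> = M * r / 12" using k pos by simp
    also have "\<dots> \<le> M * r / 10" using M_pos r_pos by simp
    finally show "2 * \<kappa>\<^sup>2 * \<rho> * acc \<le> M * r / 10" .
  qed simp
  finally show ?thesis .
next
  case False
  have "norm (schur_hess f (x t, y t) u - hess (primal f) (x t) u)
      \<le> norm (schur_hess f (x t, y t) u) + norm (schur_hess f (x t, y_star f (x t)) u)"
    unfolding hess_primal by (rule norm_triangle_ineq4)
  also have "\<dots> \<le> 2 * \<kappa> * l * norm u + 2 * \<kappa> * l * norm u"
    by (intro add_mono schur_hess_bound)
  also have "\<dots> = 4 * \<kappa> * l * norm u" by simp
  also have "\<dots> \<le> M * r / 10 * norm u"
    using False by (intro mult_right_mono) auto
  finally show ?thesis .
qed

lemma inexact_step: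
  assumes "t < N"
  shows "inexact_cubic_step (grad_x f (x t, y t)) (schur_hess f (x t, y t)) M (s t)
    (primal f) (hess (primal f)) (x t) r"
proof (intro inexact_cubic_step.intro cubic_minimizer.intro inexact_cubic_step_axioms.intro)
  show "cubic_model (grad_x f (x t, y t)) (schur_hess f (x t, y t)) M (s t)
      \<le> cubic_model (grad_x f (x t, y t)) (schur_hess f (x t, y t)) M w" for w
    using s_minimal[OF assms] by (simp add: is_arg_min_linorder)
  show "GDERIV (primal f) w :> grad (primal f) w" for w
    using GDERIV_primal[of w] by (simp add: grad_primal)
  show "(grad (primal f) has_derivative hess (primal f) w) (at w)" for w
    using has_derivative_grad_primal[of w] by (simp add: hess_primal)
  show "norm (hess (primal f) v e - hess (primal f) w e) \<le> M / 2 * norm (v - w) * norm e" for v w e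
    using hess_primal_Lipschitz[of v e w] by (simp add: M mult_ac)
qed (use linear_schur_hess schur_hess_symmetric M_pos r_pos gradient_error[OF assms] hessian_error[OF assms] in auto)

lemma step_decrease:
  assumes "t < N" "r / 2 \<le> norm (s t)"
  shows "primal f (x t + s t) \<le> primal f (x t) - M / 24 * norm (s t) ^ 3"
    and "primal f (x t + s t) \<le> primal f (x t) - M * r ^ 3 / 192"
proof -
  interpret inexact_cubic_step "grad_x f (x t, y t)" "schur_hess f (x t, y t)" M "s t"
    "primal f" "hess (primal f)" "x t" r
    by (rule inexact_step[OF assms(1)])
  show d: "primal f (x t + s t) \<le> primal f (x t) - M / 24 * norm (s t) ^ 3"
    by (rule long_step_decrease[OF assms(2)])
  have "M / 24 * (r / 2) ^ 3 \<le> M / 24 * norm (s t) ^ 3"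
    using assms(2) r_pos M_pos by (intro mult_left_mono power_mono) auto
  then show "primal f (x t + s t) \<le> primal f (x t) - M * r ^ 3 / 192"
    using d by (simp add: power_divide)
qed

lemma long_step: "Suc t < N \<Longrightarrow> r / 2 \<le> norm (s t)"
  using s_long[of t] by (simp add: r_def)

lemma primal_decrease: "t < N \<Longrightarrow> primal f (x t) \<le> primal f x0 - t * (M * r ^ 3 / 192)"
proof (induction t)
  case (Suc t)
  have "primal f (x (Suc t)) \<le> primal f (x t) - M * r ^ 3 / 192"
    using step_decrease(2)[OF _ long_step[OF Suc.prems]] Suc.prems by (simp add: x_Suc)
  also have "\<dots> \<le> primal f x0 - t * (M * r ^ 3 / 192) - M * r ^ 3 / 192"
    using Suc by simp
  finally show ?case by (simp add: distrib_right add_divide_distrib)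
qed (simp add: x_0)

text \<open>A single step cannot decrease \<open>P\<close> by more than the initial gap. This is what bounds the inner running
  times.\<close>

lemma step_cubed_bound:
  assumes "Suc t < N"
  shows "M / 24 * norm (s t) ^ 3 \<le> primal f x0 - Pinf"
proof -
  have "Pinf \<le> primal f (x t + s t)" by (rule lower)
  also have "\<dots> \<le> primal f (x t) - M / 24 * norm (s t) ^ 3"
    using step_decrease(1)[OF _ long_step[OF assms]] assms by simp
  also have "\<dots> \<le> primal f x0 - M / 24 * norm (s t) ^ 3"
  proof -
    have "0 \<le> t * (M * r ^ 3 / 192)" using M_pos r_pos by simp
    then show ?thesis using primal_decrease[of t] assms by simp
  qed
  finally show ?thesis by simp
qed

text \<open>Up to rounding, the iteration budget is the number of decreases by \<open>M r\<^sup>3 / 192\<close> that exhaust the initial gap.\<close>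

lemma pass_budget: "192 * (primal f x0 - Pinf) * sqrt M * tol powr (-1.5) * (M * r ^ 3 / 192) = primal f x0 - Pinf"
proof -
  have "tol powr (-1.5) = 1 / (tol * sqrt tol)"
  proof -
    have "tol powr (-1.5) = 1 / tol powr 1.5" by (rule powr_minus_divide)
    also have "tol powr 1.5 = tol powr 1 * tol powr (1/2)" unfolding powr_add[symmetric] by simp
    finally show ?thesis using tol by (simp add: powr_half_sqrt)
  qed
  moreover have "sqrt tol = sqrt M * r"
    using r_pos by (simp add: tol_eq real_sqrt_mult)
  ultimately have "sqrt M * tol powr (-1.5) * (M * r ^ 3) = 1"
    using M_pos r_pos by (simp add: tol_eq power2_eq_square power3_eq_cube)
  then have "(primal f x0 - Pinf) * (sqrt M * tol powr (-1.5) * (M * r ^ 3)) = primal f x0 - Pinf"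
    by simp
  then show ?thesis by (simp add: mult_ac)
qed

text \<open>Otherwise all \<open>T\<close> steps are long, and since \<open>T\<close> is at least the budget plus one, together they decrease \<open>P\<close> below
  its lower bound.\<close>

lemma last_step_short: "norm (s (N - 1)) \<le> r / 2"
proof (rule ccontr)
  assume neg: "\<not> ?thesis"
  define c where "c = M * r ^ 3 / 192"
  define B where "B = 192 * (primal f x0 - Pinf) * sqrt M * tol powr (-1.5)"
  have c: "0 < c" using M_pos r_pos by (simp add: c_def)
  have last: "N - 1 < N" using N_pos by simp
  have "N = T" using stopped neg by (simp add: r_def)
  then have "B + 1 \<le> real N" using T unfolding B_def by linarith
  then have "(B + 1) * c \<le> real N * c" using c by (intro mult_right_mono) auto
  moreover have "B * c = primal f x0 - Pinf" unfolding B_def c_def by (rule pass_budget)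
  moreover have "Pinf \<le> primal f x0 - real N * c"
  proof -
    have "Pinf \<le> primal f (x (N - 1) + s (N - 1))" by (rule lower)
    also have "\<dots> \<le> primal f (x (N - 1)) - c"
      unfolding c_def using neg by (intro step_decrease(2)[OF last]) simp
    also have "\<dots> \<le> primal f x0 - real (N - 1) * c - c"
      using primal_decrease[OF last] by (simp add: c_def)
    also have "\<dots> = primal f x0 - real N * c"
      using N_pos by (simp add: of_nat_diff algebra_simps)
    finally show ?thesis .
  qed
  ultimately show False using c by (simp add: distrib_right)
qed

lemma output_gradient: "norm (grad (primal f) (mcn_output x s N)) \<le> tol"
  and output_curvature: "- sqrt (M * tol) * (v \<bullet> v) \<le> v \<bullet> hess (primal f) (mcn_output x s N) v"
proof -
  have last: "N - 1 < N" using N_pos by simp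
  interpret inexact_cubic_step "grad_x f (x (N - 1), y (N - 1))" "schur_hess f (x (N - 1), y (N - 1))" M "s (N - 1)"
    "primal f" "hess (primal f)" "x (N - 1)" r
    by (rule inexact_step[OF last])
  show "norm (grad (primal f) (mcn_output x s N)) \<le> tol"
    unfolding mcn_output_def tol_eq by (rule short_step_gradient[OF last_step_short])
  show "- sqrt (M * tol) * (v \<bullet> v) \<le> v \<bullet> hess (primal f) (mcn_output x s N) v"
    unfolding mcn_output_def sqrt_M_tol by (rule short_step_curvature[OF last_step_short])
qed

end

section \<open>Oracle complexity\<close>

lemma two_powr_neg_five_halves: "2 powr (- 2.5) = 1 / (4 * sqrt 2)"
proof -
  have "2 powr (2.5 :: real) = 2 powr 2 * 2 powr (1/2)" unfolding powr_add[symmetric] by simp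
  also have "\<dots> = 4 * sqrt 2" by (simp add: powr_half_sqrt)
  finally show ?thesis by (simp add: powr_minus_divide)
qed

lemma sqrt_cube: "0 < a \<Longrightarrow> sqrt (a ^ 3) = a powr 1.5"
proof -
  assume "0 < a"
  then have "sqrt (a ^ 3) = (a powr 3) powr (1/2)" by (simp add: powr_half_sqrt powr_numeral)
  also have "\<dots> = a powr 1.5" by (simp add: powr_powr)
  finally show ?thesis .
qed

text \<open>Rounding and the additional call cost at most 2, which is at most \<open>4 sqrt \<kappa> ln W\<close> because \<open>W \<ge> 2\<close>.\<close>

lemma ceiling_log_bound:
  assumes "0 \<le> A" "A \<le> W ^ 20" "2 \<le> W" "1 \<le> \<kappa>"
  shows "real (nat \<lceil>2 * sqrt \<kappa> * ln A\<rceil>) + 1 \<le> 44 * (sqrt \<kappa> * ln W)"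
proof -
  have lnW: "1 / 2 \<le> ln W"
  proof -
    have "1 / 2 \<le> ln (2 :: real)" using ln2_ge_two_thirds by simp
    also have "\<dots> \<le> ln W" using assms by simp
    finally show ?thesis .
  qed
  \<comment> \<open>for \<open>A = 0\<close> the logarithm has the default value 0\<close>
  have "ln A \<le> 20 * ln W"
  proof (cases "A = 0")
    case False
    then have "ln A \<le> ln (W ^ 20)" using assms by simp
    then show ?thesis using assms by (simp add: ln_realpow)
  qed (use lnW in simp)
  then have "sqrt \<kappa> * ln A \<le> sqrt \<kappa> * (20 * ln W)" using assms by (intro mult_left_mono) auto
  moreover have "1 * (1 / 2) \<le> sqrt \<kappa> * ln W" using assms lnW by (intro mult_mono) auto
  ultimately show ?thesis by linarith
qed

locale mcn_complexity = mcn_execution +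
  fixes \<epsilon> :: real
  assumes eps: "0 < \<epsilon>" and tol_eps: "tol = 2 powr (- 2.5) * \<epsilon>"
begin

definition gap :: real where "gap = primal f x0 - Pinf"

text \<open>The order of the number of passes, without the constant term for the first pass.\<close>

definition work :: real where "work = gap * (\<kappa> powr 1.5 * sqrt \<rho> * \<epsilon> powr (-1.5))"

definition problem_size :: real where
  "problem_size = 2 + \<kappa> + l + \<rho> + 1 / \<epsilon> + norm (y_star f x0) + gap"

text \<open>All quantities under logarithms in the prescribed inner step numbers are bounded by powers of this number.
  The summand \<open>1/\<rho>\<close> is needed because a small \<open>M\<close> allows long steps.\<close>

definition log_arg :: real where "log_arg = problem_size + 1 / \<rho>"

lemma gap_nonneg: "0 \<le> gap"
  using lower[of x0] by (simp add: gap_def)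

lemma work_nonneg: "0 \<le> work"
  using gap_nonneg pos by (simp add: work_def)

lemma M_tol_eq: "M * tol = \<kappa> ^ 3 * (\<rho> * \<epsilon>)"
  unfolding M tol_eps two_powr_neg_five_halves by simp

lemma sqrt_M_tol_eq: "sqrt (M * tol) = \<kappa> powr 1.5 * sqrt (\<rho> * \<epsilon>)"
  using kappa_ge_1 by (simp add: M_tol_eq real_sqrt_mult sqrt_cube)

lemma tol_bounds: "\<epsilon> / 8 \<le> tol" "tol \<le> \<epsilon>"
proof -
  have s: "1 \<le> 4 * sqrt 2" "4 * sqrt 2 \<le> (8 :: real)"
  proof -
    have "1 \<le> sqrt 2" "sqrt 2 \<le> (2 :: real)" by (simp_all add: real_le_lsqrt)
    then show "1 \<le> 4 * sqrt 2" "4 * sqrt 2 \<le> (8 :: real)" by linarith+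
  qed
  then have "1 / 8 \<le> 1 / (4 * sqrt 2)" "1 / (4 * sqrt 2) \<le> (1 :: real)"
    using frac_le[of 1 1 "4 * sqrt 2" 8] frac_le[of 1 1 1 "4 * sqrt 2"] by simp_all
  then have "1 / 8 * \<epsilon> \<le> 1 / (4 * sqrt 2) * \<epsilon>" "1 / (4 * sqrt 2) * \<epsilon> \<le> 1 * \<epsilon>"
    using eps by (intro mult_right_mono; simp)+
  then show "\<epsilon> / 8 \<le> tol" "tol \<le> \<epsilon>"
    unfolding tol_eps two_powr_neg_five_halves by simp_all
qed

text \<open>The constant comes from \<open>sqrt M \<le> 5/2 (\<kappa> powr 1.5) sqrt \<rho>\<close> and \<open>tol\<close> to the power \<open>-1.5\<close> being at most 16 times
  that of \<open>\<epsilon>\<close>: \<open>192 \<cdot> 5/2 \<cdot> 16 = 7680\<close>. The summand 2 covers the rounding and the additional pass.\<close>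

lemma pass_bound: "real N \<le> 8000 * work + 2"
proof -
  have "192 * gap * sqrt M * tol powr (-1.5) \<le> 8000 * work"
  proof -
    have "sqrt M \<le> 5 / 2 * (\<kappa> powr 1.5 * sqrt \<rho>)"
    proof -
      have "sqrt 2 \<le> (3 / 2 :: real)" by (rule real_le_lsqrt) (simp_all add: power2_eq_square)
      then have "sqrt (4 * sqrt 2) \<le> 5 / 2" by (intro real_le_lsqrt) (simp_all add: power2_eq_square)
      then have "sqrt (4 * sqrt 2) * (sqrt (\<kappa> ^ 3) * sqrt \<rho>) \<le> 5 / 2 * (sqrt (\<kappa> ^ 3) * sqrt \<rho>)"
        using pos kappa_ge_1 by (intro mult_right_mono) auto
      then show ?thesis using kappa_ge_1 by (simp add: M real_sqrt_mult sqrt_cube mult.assoc)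
    qed
    moreover have "tol powr (-1.5) \<le> 16 * \<epsilon> powr (-1.5)"
    proof -
      have "tol powr (-1.5) = (2 powr (- 2.5)) powr (-1.5) * \<epsilon> powr (-1.5)"
        using eps by (simp add: tol_eps powr_mult)
      also have "(2 powr (- 2.5)) powr (-1.5) = 2 powr (3.75 :: real)" by (simp add: powr_powr)
      also have "(2 :: real) powr 3.75 \<le> 2 powr 4" by (rule powr_mono) auto
      finally show ?thesis by (simp add: mult_right_mono)
    qed
    ultimately have "192 * gap * (sqrt M * tol powr (-1.5))
        \<le> 192 * gap * ((5 / 2 * (\<kappa> powr 1.5 * sqrt \<rho>)) * (16 * \<epsilon> powr (-1.5)))"
      using gap_nonneg pos M_pos by (intro mult_left_mono mult_mono) auto
    also have "\<dots> = 7680 * work" by (simp add: work_def)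
    also have "\<dots> \<le> 8000 * work" using work_nonneg by simp
    finally show ?thesis by (simp add: mult.assoc)
  qed
  moreover have "0 \<le> 192 * gap * sqrt M * tol powr (-1.5)"
    using gap_nonneg M_pos by simp
  then have "real T \<le> 192 * gap * sqrt M * tol powr (-1.5) + 2"
    unfolding T gap_def[symmetric] by linarith
  moreover have "real N \<le> real T" using N_le_T by simp
  ultimately show ?thesis by linarith
qed

lemma problem_size_ge: "2 \<le> problem_size" "\<kappa> \<le> problem_size" "1 / \<epsilon> \<le> problem_size" "gap \<le> problem_size"
  using pos kappa_ge_1 eps gap_nonneg norm_ge_zero[of "y_star f x0"]
  by (simp_all add: problem_size_def add_nonneg_nonneg)

lemma log_arg_ge: "2 \<le> log_arg" "\<kappa> + 1 \<le> log_arg" "l \<le> log_arg" "\<rho> \<le> log_arg" "1 / \<epsilon> \<le> log_arg"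
    "1 / \<rho> \<le> log_arg" "gap \<le> log_arg" "norm (y_star f x0) \<le> log_arg"
  using pos kappa_ge_1 eps gap_nonneg norm_ge_zero[of "y_star f x0"]
  by (simp_all add: log_arg_def problem_size_def add_nonneg_nonneg)

text \<open>Numerical constants are absorbed in powers of \<open>log_arg\<close>, which is at least 2.\<close>

lemma inverse_acc_bound: "1 / acc \<le> log_arg ^ 13"
proof -
  note W = log_arg_ge
  have "1 \<le> log_arg ^ 13 * (1 / 192 * tol / l)"
  proof -
    have "2 ^ 11 * (l * (1 / \<epsilon>)) \<le> log_arg ^ 11 * (log_arg * log_arg)"
      using W pos eps by (intro mult_mono power_mono) auto
    also have "\<dots> = log_arg ^ 13" by (simp add: power_numeral_reduce)
    finally have "2048 * (l / \<epsilon>) * (1 / 192 * tol / l) \<le> log_arg ^ 13 * (1 / 192 * tol / l)"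
      using tol pos by (intro mult_right_mono) auto
    moreover have "1 \<le> 2048 * (l / \<epsilon>) * (1 / 192 * tol / l)"
      using pos eps tol_bounds(1) by (simp add: field_simps)
    ultimately show ?thesis by linarith
  qed
  moreover have "1 \<le> log_arg ^ 13 * (1 / 48 * sqrt (M * tol) / \<rho>)"
  proof (rule power2_le_imp_le)
    have "2 ^ 24 * (\<rho> * (1 / \<epsilon>)) \<le> log_arg ^ 24 * (log_arg * log_arg)"
      using W pos eps by (intro mult_mono power_mono) auto
    also have "\<dots> = (log_arg ^ 13)\<^sup>2" by (simp add: power_numeral_reduce)
    finally have "2 ^ 24 * (\<rho> * (1 / \<epsilon>)) * (M * tol / (2304 * \<rho>\<^sup>2)) \<le> (log_arg ^ 13)\<^sup>2 * (M * tol / (2304 * \<rho>\<^sup>2))"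
      using tol M_pos by (intro mult_right_mono) auto
    moreover have "2 ^ 24 * (\<rho> * (1 / \<epsilon>)) * (M * tol / (2304 * \<rho>\<^sup>2)) = 2 ^ 24 / 2304 * \<kappa> ^ 3"
      using pos eps by (simp add: M_tol_eq power2_eq_square)
    moreover have "1 \<le> \<kappa> ^ 3" using kappa_ge_1 by (rule one_le_power)
    moreover have "(log_arg ^ 13)\<^sup>2 * (M * tol / (2304 * \<rho>\<^sup>2)) = (log_arg ^ 13 * (1 / 48 * sqrt (M * tol) / \<rho>))\<^sup>2"
      using tol M_pos by (simp add: power_mult_distrib power_divide)
    ultimately show "1\<^sup>2 \<le> (log_arg ^ 13 * (1 / 48 * sqrt (M * tol) / \<rho>))\<^sup>2" by simp
  qed (use W tol M_pos pos in auto)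
  ultimately have "1 \<le> log_arg ^ 13 * acc" unfolding acc by (simp add: min_def)
  then show ?thesis using acc_pos by (simp add: field_simps)
qed

lemma step_length_bound:
  assumes "Suc t < N"
  shows "norm (s t) \<le> log_arg\<^sup>2"
proof -
  note W = log_arg_ge
  have "5 * \<rho> \<le> M"
  proof -
    have "5 * \<rho> * 1 \<le> 5 * \<rho> * \<kappa> ^ 3" using pos kappa_ge_1 by (intro mult_left_mono) auto
    then show ?thesis using M_ge by (simp add: mult_ac)
  qed
  then have "5 * \<rho> / 24 * norm (s t) ^ 3 \<le> M / 24 * norm (s t) ^ 3" by (intro mult_right_mono) auto
  also have "\<dots> \<le> gap" unfolding gap_def by (rule step_cubed_bound[OF assms])
  finally have "norm (s t) ^ 3 \<le> 24 / 5 * (gap * (1 / \<rho>))" using pos by (simp add: field_simps)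
  also have "\<dots> \<le> log_arg ^ 4 * (log_arg * log_arg)"
  proof (intro mult_mono)
    have "(2 :: real) ^ 4 \<le> log_arg ^ 4" using W by (intro power_mono) auto
    then show "24 / 5 \<le> log_arg ^ 4" by simp
  qed (use W pos gap_nonneg in auto)
  also have "\<dots> = (log_arg\<^sup>2) ^ 3" by (simp add: power_numeral_reduce)
  finally have "norm (s t) ^ 3 \<le> (log_arg\<^sup>2) ^ 3" .
  then have "norm (s t) ^ Suc 2 \<le> (log_arg\<^sup>2) ^ Suc 2" by (simp only: eval_nat_numeral)
  then show ?thesis by (rule power_le_imp_le_base) simp
qed

lemma calls_per_pass:
  assumes "t < N"
  shows "real (nat (K t)) + 1 \<le> 44 * (sqrt \<kappa> * ln log_arg)"
proof -
  note W = log_arg_ge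
  have root: "0 \<le> sqrt (\<kappa> + 1)" "sqrt (\<kappa> + 1) \<le> log_arg"
  proof -
    have "sqrt (\<kappa> + 1) \<le> \<kappa> + 1"
      using kappa_ge_1 by (intro real_le_lsqrt) (simp_all add: power2_eq_square algebra_simps)
    then show "0 \<le> sqrt (\<kappa> + 1)" "sqrt (\<kappa> + 1) \<le> log_arg" using W kappa_ge_1 by auto
  qed
  show ?thesis
  proof (cases t)
    case 0
    have "sqrt (\<kappa> + 1) / acc * norm (y_star f x0) = sqrt (\<kappa> + 1) * (1 / acc) * norm (y_star f x0)"
      by simp
    also have "\<dots> \<le> log_arg * log_arg ^ 13 * log_arg"
      using root inverse_acc_bound acc_pos W by (intro mult_mono) auto
    also have "\<dots> = log_arg ^ 15" by (simp add: power_numeral_reduce)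
    also have "\<dots> \<le> log_arg ^ 20" using W by (intro power_increasing) auto
    finally have "sqrt (\<kappa> + 1) / acc * norm (y_star f x0) \<le> log_arg ^ 20" .
    then show ?thesis unfolding 0 K_0
      using W kappa_ge_1 acc_pos by (intro ceiling_log_bound) auto
  next
    case (Suc j)
    have j: "Suc j < N" using assms Suc by simp
    have "sqrt (\<kappa> + 1) / acc * (acc + \<kappa> * norm (s j)) = sqrt (\<kappa> + 1) * (1 + (1 / acc) * \<kappa> * norm (s j))"
      using acc_pos by (simp add: field_simps)
    also have "\<dots> \<le> log_arg * (log_arg ^ 16 + log_arg ^ 16)"
    proof (intro mult_mono add_mono)
      show "1 \<le> log_arg ^ 16" using W by (intro one_le_power) simp
      have "(1 / acc) * \<kappa> * norm (s j) \<le> log_arg ^ 13 * log_arg * log_arg\<^sup>2"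
        using inverse_acc_bound step_length_bound[OF j] acc_pos W kappa_ge_1 by (intro mult_mono) auto
      then show "(1 / acc) * \<kappa> * norm (s j) \<le> log_arg ^ 16" by (simp add: power_numeral_reduce mult_ac)
    qed (use root W acc_pos kappa_ge_1 in auto)
    also have "\<dots> = 2 * log_arg ^ 17" by (simp add: power_numeral_reduce)
    also have "\<dots> \<le> log_arg * log_arg ^ 17" using W by (intro mult_right_mono) auto
    also have "\<dots> = log_arg ^ 18" by (simp add: power_numeral_reduce)
    also have "\<dots> \<le> log_arg ^ 20" using W by (intro power_increasing) auto
    finally have "sqrt (\<kappa> + 1) / acc * (acc + \<kappa> * norm (s j)) \<le> log_arg ^ 20" .
    then show ?thesis unfolding Suc K_Suc[OF j]
      using W kappa_ge_1 acc_pos by (intro ceiling_log_bound) auto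
  qed
qed

text \<open>Once the number of passes is not bounded by a constant, \<open>1/\<rho>\<close> is itself polynomially bounded in the other
  parameters: \<open>work\<^sup>2 = gap\<^sup>2 \<kappa>\<^sup>3 \<rho> / \<epsilon>\<^sup>3 \<ge> 1\<close>.\<close>

lemma log_arg_le_problem_size_power:
  assumes "1 \<le> work"
  shows "log_arg \<le> problem_size ^ 9"
proof -
  have "1 / \<rho> \<le> problem_size ^ 8"
  proof -
    have e: "(\<epsilon> powr (-1.5))\<^sup>2 = (1 / \<epsilon>) ^ 3"
    proof -
      have "(\<epsilon> powr (-1.5))\<^sup>2 = \<epsilon> powr (-3)" using eps by (simp add: power2_eq_square powr_add[symmetric])
      also have "\<dots> = 1 / \<epsilon> powr 3" by (rule powr_minus_divide)
      finally show ?thesis using eps by (simp add: powr_numeral power_one_over)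
    qed
    have k: "(\<kappa> powr 1.5)\<^sup>2 = \<kappa> ^ 3"
    proof -
      have "sqrt (\<kappa> ^ 3) = \<kappa> powr 1.5" by (rule sqrt_cube) (use kappa_ge_1 in simp)
      then show ?thesis using kappa_ge_1 by (metis real_sqrt_pow2 zero_le_power order_trans zero_le_one)
    qed
    have "1\<^sup>2 \<le> work\<^sup>2" using assms by (intro power_mono) auto
    also have "work\<^sup>2 = gap\<^sup>2 * (\<kappa> ^ 3 * \<rho> * (1 / \<epsilon>) ^ 3)"
      unfolding work_def power_mult_distrib e k using pos by simp
    finally have "1 / \<rho> \<le> gap\<^sup>2 * \<kappa> ^ 3 * (1 / \<epsilon>) ^ 3"
      using pos by (simp add: divide_le_eq mult_ac)
    also have "\<dots> \<le> problem_size\<^sup>2 * problem_size ^ 3 * problem_size ^ 3"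
      using problem_size_ge gap_nonneg kappa_ge_1 eps by (intro mult_mono power_mono) auto
    also have "\<dots> = problem_size ^ 8" by (simp add: power_numeral_reduce)
    finally show ?thesis .
  qed
  moreover have "problem_size \<le> problem_size ^ 8" using problem_size_ge(1) by (intro self_le_power) auto
  moreover have "2 * problem_size ^ 8 \<le> problem_size * problem_size ^ 8" using problem_size_ge(1) by (intro mult_right_mono) auto
  moreover have "problem_size * problem_size ^ 8 = problem_size ^ 9" by (simp add: power_numeral_reduce)
  ultimately show ?thesis unfolding log_arg_def by linarith
qed

lemma hessian_and_solver_calls_bound:
  "real (hessian_calls N + cubic_solver_calls N) \<le> abs_const * hessian_order gap \<kappa> \<rho> \<epsilon>"
proof -
  have "real (hessian_calls N + cubic_solver_calls N) = 2 * real N"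
    by (simp add: hessian_calls_def cubic_solver_calls_def)
  also have "\<dots> \<le> 2 * (8000 * work + 2)" using pass_bound by simp
  also have "\<dots> \<le> 10 ^ 7 * (work + 1)" using work_nonneg by simp
  finally show ?thesis by (simp add: abs_const_def hessian_order_def work_def)
qed

text \<open>If \<open>work \<ge> 1\<close>, the logarithm of \<open>log_arg\<close> is at most 9 times that of \<open>problem_size\<close> and the main term of the order dominates;
  otherwise the number of passes is bounded by a constant and the second term of the order suffices.\<close>

lemma gradient_calls_bound:
  "real (gradient_calls K N) \<le> abs_const * gradient_order gap \<kappa> l \<rho> \<epsilon> (norm (y_star f x0))"
proof -
  define u where "u = sqrt \<kappa> * ln log_arg"
  define v where "v = sqrt \<kappa> * ln problem_size"
  have uv: "0 \<le> u" "0 \<le> v" using problem_size_ge(1) log_arg_ge(1) kappa_ge_1 by (auto simp: u_def v_def)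
  have "real (gradient_calls K N) = (\<Sum>t<N. real (nat (K t)) + 1)"
    by (simp add: gradient_calls_def sum.distrib)
  also have "\<dots> \<le> (\<Sum>t<N. 44 * u)"
    unfolding u_def by (intro sum_mono calls_per_pass) simp
  also have "\<dots> = 44 * (real N * u)" by simp
  also have "\<dots> \<le> 44 * ((8000 * work + 2) * u)"
    using pass_bound uv by (intro mult_left_mono mult_right_mono) auto
  also have "\<dots> \<le> 10 ^ 7 * (work * v + u)"
  proof (cases "1 \<le> work")
    case True
    have "ln log_arg \<le> ln (problem_size ^ 9)" using log_arg_le_problem_size_power[OF True] log_arg_ge(1) problem_size_ge(1) by simp
    also have "\<dots> = 9 * ln problem_size" using problem_size_ge(1) by (simp add: ln_realpow)
    finally have "sqrt \<kappa> * ln log_arg \<le> sqrt \<kappa> * (9 * ln problem_size)"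
      using kappa_ge_1 by (intro mult_left_mono) auto
    then have "u \<le> 9 * v" by (simp add: u_def v_def)
    then have "work * u \<le> work * (9 * v)" using work_nonneg by (intro mult_left_mono)
    then have "44 * ((8000 * work + 2) * u) \<le> 44 * 8000 * 9 * (work * v) + 88 * u"
      by (simp add: algebra_simps)
    also have "\<dots> \<le> 10 ^ 7 * (work * v + u)"
      using work_nonneg uv by (simp add: mult_nonneg_nonneg)
    finally show ?thesis .
  next
    case False
    then have "work * u \<le> 1 * u" using uv by (intro mult_right_mono) auto
    then have "44 * ((8000 * work + 2) * u) \<le> 44 * 8002 * u" by (simp add: algebra_simps)
    also have "\<dots> \<le> 10 ^ 7 * (work * v + u)"
      using work_nonneg uv by (simp add: mult_nonneg_nonneg)
    finally show ?thesis .
  qed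
  also have "work * v = gap * (\<kappa>\<^sup>2 * sqrt \<rho> * \<epsilon> powr (-1.5)) * ln problem_size"
  proof -
    have "\<kappa> powr 1.5 * sqrt \<kappa> = \<kappa>\<^sup>2"
      using kappa_ge_1 by (simp add: powr_half_sqrt[symmetric] powr_add[symmetric] powr_numeral)
    moreover have "work * v = gap * ((\<kappa> powr 1.5 * sqrt \<kappa>) * sqrt \<rho> * \<epsilon> powr (-1.5)) * ln problem_size"
      unfolding work_def v_def by (simp only: mult_ac)
    ultimately show ?thesis by (simp only:)
  qed
  finally show ?thesis
    by (simp add: abs_const_def gradient_order_def Let_def problem_size_def[symmetric] u_def log_arg_def)
qed

lemma output_second_order_stationary:
  "second_order_stationary (primal f) \<epsilon> (\<kappa> powr 1.5 * sqrt (\<rho> * \<epsilon>)) (mcn_output x s N)"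
  unfolding second_order_stationary_def sqrt_M_tol_eq[symmetric]
  using twice_differentiable_primal output_gradient tol_bounds(2) output_curvature by force

end

theorem corollary1:
  fixes f :: "'a::euclidean_space \<times> 'b::euclidean_space \<Rightarrow> real"
    and l \<rho> \<mu> \<kappa> \<epsilon> M C\<^sub>g C\<^sub>H \<epsilon>' \<epsilon>t Pinf :: real
    and x0 :: 'a and T N :: nat and K :: "nat \<Rightarrow> int"
    and x s :: "nat \<Rightarrow> 'a" and y :: "nat \<Rightarrow> 'b"
  assumes pos: "l > 0" "\<rho> > 0" "\<mu> > 0"
    and diff: "twice_differentiable f"
    and A1: "\<forall>x x' y y'. (norm (grad f (x, y) - grad f (x', y')))\<^sup>2
               \<le> l\<^sup>2 * ((norm (x - x'))\<^sup>2 + (norm (y - y'))\<^sup>2)"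
    and A2: "\<forall>x x' y y'. (onorm (\<lambda>w. hess f (x, y) w - hess f (x', y') w))\<^sup>2
               \<le> \<rho>\<^sup>2 * ((norm (x - x'))\<^sup>2 + (norm (y - y'))\<^sup>2)"
    and A3: "\<forall>x y y'. f (x, y) \<le> f (x, y') + grad_y f (x, y') \<bullet> (y - y')
               - \<mu> / 2 * (norm (y - y'))\<^sup>2"
    and A4: "bdd_below (range (primal f))"
    and Pinf: "Pinf = (INF x. primal f x)"
    and kappa: "\<kappa> = l / \<mu>"
    and eps: "\<epsilon> > 0"
    and M: "M = 4 * sqrt 2 * \<kappa> ^ 3 * \<rho>"
    and Cg: "C\<^sub>g = 1 / 192"
    and CH: "C\<^sub>H = 1 / 48"
    and eps': "\<epsilon>' = 2 powr (-2.5) * \<epsilon>"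
    and epst: "\<epsilon>t = min (C\<^sub>g * \<epsilon>' / l) (C\<^sub>H * sqrt (M * \<epsilon>') / \<rho>)"
    and T: "T = nat (\<lceil>192 * (primal f x0 - Pinf) * sqrt M * \<epsilon>' powr (-1.5)\<rceil> + 1)"
    and K_0: "K 0 = \<lceil>2 * sqrt \<kappa> * ln (sqrt (\<kappa> + 1) / \<epsilon>t * norm (y_star f x0))\<rceil>"
    and K_Suc: "\<forall>t. Suc t < N \<longrightarrow>
       K (Suc t) = \<lceil>2 * sqrt \<kappa> * ln (sqrt (\<kappa> + 1) / \<epsilon>t * (\<epsilon>t + \<kappa> * norm (s t)))\<rceil>"
    and run: "mcn_run f l \<kappa> M \<epsilon>' T K x0 x y s N"
  shows "second_order_stationary (primal f) \<epsilon> (\<kappa> powr 1.5 * sqrt (\<rho> * \<epsilon>)) (mcn_output x s N) \<and>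
    real (gradient_calls K N)
      \<le> abs_const * gradient_order (primal f x0 - Pinf) \<kappa> l \<rho> \<epsilon> (norm (y_star f x0)) \<and>
    real (hessian_calls N + cubic_solver_calls N)
      \<le> abs_const * hessian_order (primal f x0 - Pinf) \<kappa> \<rho> \<epsilon>"
proof -
  interpret mcn_complexity f l \<rho> \<mu> \<kappa> \<epsilon>' M "sqrt (\<epsilon>' / M)" \<epsilon>t Pinf x0 T N K x s y \<epsilon>
  proof unfold_locales
    show "0 < \<epsilon>'" using eps by (simp add: eps')
    show "Pinf \<le> primal f w" for w unfolding Pinf using A4 by (intro cINF_lower) auto
    show "\<epsilon>t = min (1 / 192 * \<epsilon>' / l) (1 / 48 * sqrt (M * \<epsilon>') / \<rho>)"
      unfolding epst Cg CH ..
  qed (use assms in simp_all)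
  show ?thesis
    using output_second_order_stationary gradient_calls_bound hessian_and_solver_calls_bound
    unfolding gap_def by simp
qed

end
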